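(* Let $S$ be a numerical semigroup, let $E\subseteq S$ be a (nonempty) ideal of $S$, let $d\in S$ be odd, and let $S\bowtie^d E$ be the numerical duplication of $S$ with respect to $E$ and $d$. Write $S^*=S\setminus\{0\}$ and $\tilde E=E\cup\{0\}$ (which is a numerical semigroup). Then: (i) If $E\neq S$ and $E\neq S^*$, then $\mathrm{PF}(S\bowtie^d E)=\Delta_1\cup\Delta_2$, where $$\Delta_1=\{2f \mid f\in \mathrm{PF}(S)\cap\mathrm{PF}(\tilde E)\},$$ $$\Delta_2=\{2f+d \mid f\in\mathrm{PF}(\tilde E)\ \text{and}\ f+s\in E\ \text{for all}\ s\in S\setminus\tilde E\}.$$ (ii) If $E=S^*$, then $\mathrm{PF}(S\bowtie^d E)=\{d,\,2f,\,2f+d \mid f\in\mathrm{PF}(S)\}$. (iii) If $E=S$, then $\mathrm{PF}(S\bowtie^d E)=\{2f+d\mid f\in\mathrm{PF}(S)\}$. Moreover, the Cohen-Macaulay type of $k[[S\bowtie^d E]]$ is $|\Delta_1\cup\Delta_2|$ if $E\neq S,S^*$; it is $2\,\mathrm{type}(k[[S]])+1$ if $E=S^*$; and it is equal to the Cohen-Macaulay type of $k[[S]]$ if $E=S$.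
   Context: $\mathbb{N}$ denotes the non-negative integers. A numerical semigroup is a submonoid $S$ of $(\mathbb{N},+)$ with $\mathbb{N}\setminus S$ finite. A pseudo-Frobenius number of $S$ is an integer $f\in\mathbb{Z}\setminus S$ with $f+s\in S$ for all $s\in S\setminus\{0\}$; $\mathrm{PF}(S)$ is the set of these. An ideal of $S$ is a subset $E\subseteq S$ with $S+E\subseteq E$. For an odd integer $d\in S$ and an ideal $E\subseteq S$, the numerical duplication of $S$ with respect to $E$ and $d$ is the numerical semigroup $S\bowtie^d E = 2\cdot S\cup(2\cdot E+d)$, where $2\cdot S=\{2s\mid s\in S\}$ and $2\cdot E+d=\{2e+d\mid e\in E\}$. Let $k$ be an algebraically closed field of characteristic zero; for $S$ minimally generated by $n_1,\ldots,n_e$, $k[[S]]:=k[[t^{n_1},\ldots,t^{n_e}]]\subseteq k[[t]]$, and $\mathrm{type}(k[[S]])$ is its Cohen-Macaulay type, which equals $|\mathrm{PF}(S)|$.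
   Formalization: For E = S*, part (ii) and its type formula assume S ≠ ℕ: if S = ℕ and E = ℕ∖{0}, the duplication is ⟨2, d+2⟩ with PF = {d} and type 1, whereas the stated formulas give {d, −2, d−2} and 3, so the claim fails for every odd d. *)

theory Defs
  imports
    "HOL-Computational_Algebra.Computational_Algebra"
    "HOL-Algebra.QuotRing"
    "Jordan_Normal_Form.Missing_VectorSpace"
begin

section \<open>Numerical semigroups\<close>

definition numerical_semigroup :: "nat set \<Rightarrow> bool" where
  "numerical_semigroup S \<longleftrightarrow>
     0 \<in> S \<and> (\<forall>a\<in>S. \<forall>b\<in>S. a + b \<in> S) \<and> finite (UNIV - S)"

text \<open>Pseudo-Frobenius numbers are integers: for the semigroup of all naturals the set is
  \<open>{-1}\<close>.\<close>

definition PF :: "nat set \<Rightarrow> int set" where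
  "PF S = {f. f \<notin> int ` S \<and> (\<forall>s\<in>S - {0}. f + int s \<in> int ` S)}"

definition semigroup_ideal :: "nat set \<Rightarrow> nat set \<Rightarrow> bool" where
  "semigroup_ideal S E \<longleftrightarrow> E \<subseteq> S \<and> (\<forall>s\<in>S. \<forall>e\<in>E. s + e \<in> E)"

definition numerical_duplication :: "nat set \<Rightarrow> nat set \<Rightarrow> nat \<Rightarrow> nat set" where
  "numerical_duplication S E d = {2 * s | s. s \<in> S} \<union> {2 * e + d | e. e \<in> E}"

definition Delta1 :: "nat set \<Rightarrow> nat set \<Rightarrow> int set" where
  "Delta1 S E = {2 * f | f. f \<in> PF S \<inter> PF (E \<union> {0})}"

definition Delta2 :: "nat set \<Rightarrow> nat set \<Rightarrow> nat \<Rightarrow> int set" where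
  "Delta2 S E d = {2 * f + int d | f.
     f \<in> PF (E \<union> {0}) \<and> (\<forall>s\<in>S - (E \<union> {0}). f + int s \<in> int ` E)}"

lemma numerical_semigroup_tilde:
  assumes S: "numerical_semigroup S" and E: "semigroup_ideal S E" "E \<noteq> {}"
  shows "numerical_semigroup (E \<union> {0})"
proof -
  obtain e where e: "e \<in> E" using E by auto
  have "UNIV - (E \<union> {0}) \<subseteq> {..e} \<union> (\<lambda>n. n + e) ` (UNIV - S)"
  proof
    fix n assume n: "n \<in> UNIV - (E \<union> {0})"
    show "n \<in> {..e} \<union> (\<lambda>n. n + e) ` (UNIV - S)"
    proof (cases "n \<le> e")
      case False
      have "n - e \<notin> S"
      proof
        assume "n - e \<in> S"
        then have "(n - e) + e \<in> E" using E e unfolding semigroup_ideal_def by blast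
        then show False using n False by simp
      qed
      moreover have "n = (n - e) + e" using False by simp
      ultimately show ?thesis by blast
    qed simp
  qed
  moreover have "finite ({..e} \<union> (\<lambda>n. n + e) ` (UNIV - S))"
    using S unfolding numerical_semigroup_def by simp
  ultimately have "finite (UNIV - (E \<union> {0}))" by (rule finite_subset)
  then show ?thesis
    using E unfolding numerical_semigroup_def semigroup_ideal_def by auto
qed

lemma numerical_semigroup_duplication:
  assumes S: "numerical_semigroup S" and E: "semigroup_ideal S E" "E \<noteq> {}"
    and d: "d \<in> S" "odd d"
  shows "numerical_semigroup (numerical_duplication S E d)"
proof -
  let ?T = "numerical_duplication S E d"
  let ?A = "UNIV - S" and ?B = "UNIV - (E \<union> {0})"
  have fin: "finite ?A" "finite ?B"
    using S numerical_semigroup_tilde[OF S E] unfolding numerical_semigroup_def by auto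
  have "UNIV - ?T \<subseteq> (\<lambda>n. 2 * n) ` ?A \<union> {..d} \<union> (\<lambda>n. 2 * n + d) ` ?B"
  proof
    fix n assume n: "n \<in> UNIV - ?T"
    show "n \<in> (\<lambda>n. 2 * n) ` ?A \<union> {..d} \<union> (\<lambda>n. 2 * n + d) ` ?B"
    proof (cases "even n")
      case True
      then obtain m where "n = 2 * m" by auto
      then show ?thesis using n unfolding numerical_duplication_def by auto
    next
      case False
      show ?thesis
      proof (cases "n \<le> d")
        case nd: False
        have "even (n - d)" using False d(2) nd by simp
        then obtain m where m: "n - d = 2 * m" by (rule evenE)
        then have "n = 2 * m + d" "m \<noteq> 0" using nd by auto
        then show ?thesis using n unfolding numerical_duplication_def by auto
      qed simp
    qed
  qed
  then have f: "finite (UNIV - ?T)" by (rule finite_subset) (use fin in auto)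
  have cl: "a + b \<in> ?T" if ab: "a \<in> ?T" "b \<in> ?T" for a b
  proof -
    have add: "\<And>x y. x \<in> S \<Longrightarrow> y \<in> S \<Longrightarrow> x + y \<in> S"
      using S unfolding numerical_semigroup_def by blast
    have addE: "\<And>x y. x \<in> S \<Longrightarrow> y \<in> E \<Longrightarrow> x + y \<in> E" and sub: "\<And>x. x \<in> E \<Longrightarrow> x \<in> S"
      using E unfolding semigroup_ideal_def by auto
    consider s s' where "a = 2 * s" "b = 2 * s'" "s \<in> S" "s' \<in> S"
      | s e where "a = 2 * s" "b = 2 * e + d" "s \<in> S" "e \<in> E"
      | s e where "b = 2 * s" "a = 2 * e + d" "s \<in> S" "e \<in> E"
      | e e' where "a = 2 * e + d" "b = 2 * e' + d" "e \<in> E" "e' \<in> E"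
      using ab unfolding numerical_duplication_def by blast
    then show ?thesis
    proof cases
      case 1
      then have "a + b = 2 * (s + s')" "s + s' \<in> S" using add by auto
      then show ?thesis unfolding numerical_duplication_def by blast
    next
      case 2
      then have "a + b = 2 * (s + e) + d" "s + e \<in> E" using addE by auto
      then show ?thesis unfolding numerical_duplication_def by blast
    next
      case 3
      then have "a + b = 2 * (s + e) + d" "s + e \<in> E" using addE by auto
      then show ?thesis unfolding numerical_duplication_def by blast
    next
      case 4
      then have "a + b = 2 * (e + e' + d)" "e + e' + d \<in> S" using add sub d by auto
      then show ?thesis unfolding numerical_duplication_def by blast
    qed
  qed
  have "0 \<in> ?T" using S unfolding numerical_semigroup_def numerical_duplication_def by auto
  then show ?thesis using f cl unfolding numerical_semigroup_def by blast
qed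

subsection \<open>Minimal generators\<close>

definition submonoid_generated :: "nat set \<Rightarrow> nat set" where
  "submonoid_generated G = {sum_mset \<alpha> | \<alpha>. set_mset \<alpha> \<subseteq> G}"

definition minimally_generates :: "nat set \<Rightarrow> nat set \<Rightarrow> bool" where
  "minimally_generates G S \<longleftrightarrow>
     submonoid_generated G = S \<and> (\<forall>G'. G' \<subset> G \<longrightarrow> submonoid_generated G' \<noteq> S)"

definition minimal_generators :: "nat set \<Rightarrow> nat set" where
  "minimal_generators S = (THE G. minimally_generates G S)"

lemma minimal_generators_eq:
  assumes S: "numerical_semigroup S"
  defines "A \<equiv> {n \<in> S - {0}. \<not> (\<exists>a\<in>S - {0}. \<exists>b\<in>S - {0}. n = a + b)}"
  shows "minimally_generates G S \<longleftrightarrow> G = A" and "minimal_generators S = A"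
proof -
  have add: "\<And>x y. x \<in> S \<Longrightarrow> y \<in> S \<Longrightarrow> x + y \<in> S" and zero: "0 \<in> S"
    using S unfolding numerical_semigroup_def by auto
  have sum_in: "sum_mset \<alpha> \<in> S" if "set_mset \<alpha> \<subseteq> S" for \<alpha>
    using that by (induction \<alpha>) (auto simp: zero add)
  have gen: "\<exists>\<alpha>. set_mset \<alpha> \<subseteq> A \<and> sum_mset \<alpha> = n" if "n \<in> S" for n
    using that
  proof (induction n rule: less_induct)
    case (less n)
    consider "n = 0" | "n \<in> A" | a b where "a \<in> S - {0}" "b \<in> S - {0}" "n = a + b"
      using less.prems unfolding A_def by blast
    then show ?case
    proof cases
      case 1
      then show ?thesis by (intro exI[of _ "{#}"]) auto
    next
      case 2
      then show ?thesis by (intro exI[of _ "{#n#}"]) auto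
    next
      case 3
      then obtain \<alpha> \<beta> where "set_mset \<alpha> \<subseteq> A" "sum_mset \<alpha> = a" "set_mset \<beta> \<subseteq> A" "sum_mset \<beta> = b"
        using less.IH[of a] less.IH[of b] by auto
      then show ?thesis using 3 by (intro exI[of _ "\<alpha> + \<beta>"]) auto
    qed
  qed
  have genA: "submonoid_generated A = S"
  proof -
    have "A \<subseteq> S" unfolding A_def by auto
    then show ?thesis
      using gen sum_in unfolding submonoid_generated_def by blast
  qed
  have sub: "A \<subseteq> G" if G: "submonoid_generated G = S" for G
  proof
    fix a assume a: "a \<in> A"
    then have "a \<in> submonoid_generated G" using G unfolding A_def by auto
    then obtain \<alpha> where \<alpha>: "set_mset \<alpha> \<subseteq> G" "sum_mset \<alpha> = a"
      unfolding submonoid_generated_def by auto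
    have "a \<noteq> 0" using a unfolding A_def by auto
    then have "\<exists>x. x \<in># \<alpha> \<and> x \<noteq> 0" using \<alpha>(2) by (metis sum_mset_0_iff)
    then obtain x where x: "x \<in># \<alpha>" "x \<noteq> 0" by blast
    then obtain \<beta> where \<beta>: "\<alpha> = add_mset x \<beta>" by (metis insert_DiffM)
    have "set_mset {#x#} \<subseteq> G" "set_mset \<beta> \<subseteq> G" using \<alpha>(1) \<beta> by auto
    then have "sum_mset {#x#} \<in> submonoid_generated G" "sum_mset \<beta> \<in> submonoid_generated G"
      unfolding submonoid_generated_def by blast+
    then have "x \<in> S" "sum_mset \<beta> \<in> S" using G by auto
    moreover have "a = x + sum_mset \<beta>" using \<alpha>(2) \<beta> by simp
    ultimately have "sum_mset \<beta> = 0" using a x(2) unfolding A_def by blast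
    then have "a = x" using \<open>a = x + sum_mset \<beta>\<close> by simp
    then show "a \<in> G" using x \<alpha> by auto
  qed
  have iff: "minimally_generates G S \<longleftrightarrow> G = A" for G
    using genA sub unfolding minimally_generates_def by blast
  show "minimally_generates G S \<longleftrightarrow> G = A" by (rule iff)
  show "minimal_generators S = A"
    unfolding minimal_generators_def iff by simp
qed

section \<open>Semigroup rings\<close>

text \<open>
  The ring \<open>k[[t\<^sup>g | g \<in> G]]\<close> is the image of the formal power series ring in indeterminates
  \<open>x\<^sub>g\<close> (\<open>g \<in> G\<close>) under the substitution of \<open>t\<^sup>g\<close> for \<open>x\<^sub>g\<close>. A monomial in the \<open>x\<^sub>g\<close> is encoded as
  a multiset \<open>\<alpha>\<close> over \<open>G\<close>, and it is sent to \<open>t\<close> to the power \<open>sum_mset \<alpha>\<close>. As the elements of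
  \<open>G\<close> are positive and \<open>G\<close> is finite, the sums below are finite.
\<close>

definition power_series_in_monomials :: "nat set \<Rightarrow> 'k::comm_ring_1 fps set" where
  "power_series_in_monomials G =
     {Abs_fps (\<lambda>n. \<Sum>\<alpha> | set_mset \<alpha> \<subseteq> G \<and> sum_mset \<alpha> = n. c \<alpha>) | c. True}"

definition semigroup_ring :: "'k::field itself \<Rightarrow> nat set \<Rightarrow> 'k fps ring" where
  "semigroup_ring _ S =
     \<lparr>carrier = power_series_in_monomials (minimal_generators S),
      mult = (*), one = 1, zero = 0, add = (+)\<rparr>"

section \<open>Cohen-Macaulay type of a local ring\<close>

definition local_max_ideal :: "('a, 'b) ring_scheme \<Rightarrow> 'a set" where
  "local_max_ideal R = carrier R - Units R"

definition regular_sequence :: "('a, 'b) ring_scheme \<Rightarrow> 'a list \<Rightarrow> bool" where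
  "regular_sequence R xs \<longleftrightarrow>
     set xs \<subseteq> local_max_ideal R \<and>
     (\<forall>i<length xs. \<forall>a\<in>carrier R.
        a \<otimes>\<^bsub>R\<^esub> xs ! i \<in> Idl\<^bsub>R\<^esub> (set (take i xs)) \<longrightarrow> a \<in> Idl\<^bsub>R\<^esub> (set (take i xs)))"

definition maximal_regular_sequence :: "('a, 'b) ring_scheme \<Rightarrow> 'a list \<Rightarrow> bool" where
  "maximal_regular_sequence R xs \<longleftrightarrow>
     regular_sequence R xs \<and> (\<forall>x. \<not> regular_sequence R (xs @ [x]))"

text \<open>
  The socle \<open>{a \<in> R/I | \<mm> a = 0}\<close> of \<open>R/I\<close>, as a module over the residue field \<open>R/\<mm>\<close>. Its scalar
  multiplication is induced by multiplication of representatives; since \<open>\<mm>\<close> annihilates the socle,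
  the union in \<^const>\<open>rcoset_mult\<close> is a union of equal cosets of \<open>I\<close>.
\<close>

definition socle_module :: "('a, 'b) ring_scheme \<Rightarrow> 'a set \<Rightarrow> ('a set, 'a set) module" where
  "socle_module R I =
     \<lparr>carrier = {a \<in> carrier (R Quot I).
                   \<forall>r\<in>local_max_ideal R. (I +>\<^bsub>R\<^esub> r) \<otimes>\<^bsub>R Quot I\<^esub> a = \<zero>\<^bsub>R Quot I\<^esub>},
      mult = mult (R Quot I), one = one (R Quot I),
      zero = zero (R Quot I), add = add (R Quot I),
      smult = rcoset_mult R I\<rparr>"

text \<open>
  The type of a Cohen-Macaulay local ring \<open>R\<close> is the dimension over the residue field of the socle
  of \<open>R/(x\<^sub>1,\<dots>,x\<^sub>r)\<close>, where \<open>x\<^sub>1,\<dots>,x\<^sub>r\<close> is a maximal \<open>R\<close>-regular sequence in \<open>\<mm>\<close>. The dimension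
  does not depend on the sequence chosen (the socle is isomorphic to \<open>Ext\<^sup>r(R/\<mm>, R)\<close>).
\<close>

definition cm_type :: "('a, 'b) ring_scheme \<Rightarrow> nat" where
  "cm_type R =
     (let xs = (SOME xs. maximal_regular_sequence R xs)
      in vectorspace.dim (R Quot (local_max_ideal R)) (socle_module R (Idl\<^bsub>R\<^esub> (set xs))))"

end

theory Submission imports Defs
begin

text \<open>
  Two independent facts make up the proof.

  The first is that the type of \<open>R = k[[S]]\<close> is the number of pseudo-Frobenius numbers of \<open>S\<close>
  (\<open>cm_type_semigroup_ring\<close>). The ring consists of the power series with exponents in \<open>S\<close>, and its
  maximal ideal \<open>\<mm>\<close> of those without constant term. It is a one-dimensional domain, so its maximal
  regular sequences are the single nonzero elements \<open>x\<close> of \<open>\<mm>\<close>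
  (\<open>maximal_regular_sequence_iff\<close>). The socle of \<open>R/(x)\<close> is \<open>(x : \<mm>)/(x)\<close>, and division by \<open>x\<close> in
  the field of Laurent series carries it to \<open>(R : \<mm>)/R\<close>, which does not depend on \<open>x\<close>. A Laurent
  series \<open>g\<close> satisfies \<open>g \<mm> \<subseteq> R\<close> if and only if \<open>g t\<^sup>s \<in> R\<close> for all positive \<open>s \<in> S\<close>, which is a
  condition on the exponents of \<open>g\<close>: they lie in \<open>S \<union> PF(S)\<close>. So the \<open>t\<^sup>f\<close> with \<open>f \<in> PF(S)\<close> are a basis
  (\<open>socle_dim_eq_card_PF\<close>).

  The second is a parity argument. As \<open>d\<close> is odd, every integer is \<open>2 f\<close> or \<open>2 f + d\<close> for a unique \<open>f\<close>,
  and membership in the duplication means \<open>f \<in> S\<close> in the first case and \<open>f \<in> E\<close> in the second.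
  Splitting also the elements to be added by parity, \<open>2 f\<close> is pseudo-Frobenius if and only if
  \<open>f \<in> PF(S)\<close> and \<open>f + E \<subseteq> E\<close>, and \<open>2 f + d\<close> is if and only if \<open>f \<notin> E\<close> and
  \<open>f + (S - {0}) \<subseteq> E\<close> (\<open>PF_duplication\<close>). The three cases of the theorem only simplify these
  conditions.
\<close>

section \<open>The socle of a quotient of a local ring\<close>

text \<open>
  A basis that is given as a family indexed by \<open>F\<close>, rather than as a set of vectors: independence
  of the family already excludes repetitions, so the dimension is the number of indices.
\<close>

lemma (in vectorspace) dim_of_basis_family:
  assumes F: "finite F" and v: "v \<in> F \<rightarrow> carrier V"
    and indep: "\<And>c f. c \<in> F \<rightarrow> carrier K \<Longrightarrow> (\<Oplus>\<^bsub>V\<^esub>f\<in>F. c f \<odot>\<^bsub>V\<^esub> v f) = \<zero>\<^bsub>V\<^esub> \<Longrightarrow> f \<in> F \<Longrightarrow>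
      c f = \<zero>\<^bsub>K\<^esub>"
    and gen: "\<And>x. x \<in> carrier V \<Longrightarrow> \<exists>c\<in>F \<rightarrow> carrier K. x = (\<Oplus>\<^bsub>V\<^esub>f\<in>F. c f \<odot>\<^bsub>V\<^esub> v f)"
  shows "dim = card F"
proof -
  have vc: "v f \<in> carrier V" if "f \<in> F" for f using v that by blast
  have inj: "inj_on v F"
  proof (rule inj_onI, rule ccontr)
    fix f g assume fg: "f \<in> F" "g \<in> F" "v f = v g" "f \<noteq> g"
    \<comment> \<open>A repeated vector would give the nontrivial relation \<open>v f - v g = 0\<close>.\<close>
    define c where "c = (\<lambda>h. if h = f then \<one>\<^bsub>K\<^esub> else if h = g then \<ominus>\<^bsub>K\<^esub> \<one>\<^bsub>K\<^esub> else \<zero>\<^bsub>K\<^esub>)"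
    have c: "c \<in> F \<rightarrow> carrier K" unfolding c_def by auto
    have F': "F = insert f (insert g (F - {f,g}))" using fg by auto
    have cv: "c h \<odot>\<^bsub>V\<^esub> v h \<in> carrier V" if "h \<in> F" for h using that vc c by blast
    have "(\<Oplus>\<^bsub>V\<^esub>h\<in>F. c h \<odot>\<^bsub>V\<^esub> v h) = (\<Oplus>\<^bsub>V\<^esub>h\<in>insert f (insert g (F - {f,g})). c h \<odot>\<^bsub>V\<^esub> v h)"
      using F' by (rule arg_cong)
    also have "\<dots> = c f \<odot>\<^bsub>V\<^esub> v f \<oplus>\<^bsub>V\<^esub> (\<Oplus>\<^bsub>V\<^esub>h\<in>insert g (F - {f,g}). c h \<odot>\<^bsub>V\<^esub> v h)"
      by (rule M.finsum_insert) (use F fg cv cv[OF fg(1)] in auto)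
    also have "(\<Oplus>\<^bsub>V\<^esub>h\<in>insert g (F - {f,g}). c h \<odot>\<^bsub>V\<^esub> v h)
        = c g \<odot>\<^bsub>V\<^esub> v g \<oplus>\<^bsub>V\<^esub> (\<Oplus>\<^bsub>V\<^esub>h\<in>F - {f,g}. c h \<odot>\<^bsub>V\<^esub> v h)"
      by (rule M.finsum_insert) (use F fg cv in auto)
    also have "(\<Oplus>\<^bsub>V\<^esub>h\<in>F - {f,g}. c h \<odot>\<^bsub>V\<^esub> v h) = (\<Oplus>\<^bsub>V\<^esub>h\<in>F - {f,g}. \<zero>\<^bsub>V\<^esub>)"
      by (rule M.finsum_cong') (use vc in \<open>auto simp: c_def\<close>)
    also have "\<dots> = \<zero>\<^bsub>V\<^esub>" by (rule M.finsum_zero)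
    also have "c f \<odot>\<^bsub>V\<^esub> v f \<oplus>\<^bsub>V\<^esub> (c g \<odot>\<^bsub>V\<^esub> v g \<oplus>\<^bsub>V\<^esub> \<zero>\<^bsub>V\<^esub>) = v g \<oplus>\<^bsub>V\<^esub> \<ominus>\<^bsub>V\<^esub> v g"
      using vc[OF fg(2)] fg(3,4) by (simp add: c_def smult_l_minus)
    also have "\<dots> = \<zero>\<^bsub>V\<^esub>" using vc[OF fg(2)] by (rule M.r_neg)
    finally have "c f = \<zero>\<^bsub>K\<^esub>" using indep c fg by blast
    then show False by (simp add: c_def)
  qed
  have comb: "lincomb a (v ` F) = (\<Oplus>\<^bsub>V\<^esub>f\<in>F. a (v f) \<odot>\<^bsub>V\<^esub> v f)" if "a \<in> v ` F \<rightarrow> carrier K" for a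
    unfolding lincomb_def by (rule M.finsum_reindex) (use inj vc that in auto)
  have vF: "v ` F \<subseteq> carrier V" using vc by blast
  have "lin_indpt (v ` F)"
  proof (rule finite_lin_indpt2)
    fix a assume a: "a \<in> v ` F \<rightarrow> carrier K" "lincomb a (v ` F) = \<zero>\<^bsub>V\<^esub>"
    have aF: "(\<lambda>f. a (v f)) \<in> F \<rightarrow> carrier K" using a(1) by blast
    have "(\<Oplus>\<^bsub>V\<^esub>f\<in>F. a (v f) \<odot>\<^bsub>V\<^esub> v f) = \<zero>\<^bsub>V\<^esub>" using comb[OF a(1)] a(2) by (rule subst)
    then have "a (v f) = \<zero>\<^bsub>K\<^esub>" if "f \<in> F" for f by (rule indep[OF aF _ that])
    then show "\<forall>x\<in>v ` F. a x = \<zero>\<^bsub>K\<^esub>" by blast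
  qed (use F vF in auto)
  moreover have "span (v ` F) = carrier V"
  proof
    show "span (v ` F) \<subseteq> carrier V" using vF by (rule span_is_subset2)
    show "carrier V \<subseteq> span (v ` F)"
    proof
      fix x assume "x \<in> carrier V"
      then obtain c where c: "c \<in> F \<rightarrow> carrier K" "x = (\<Oplus>\<^bsub>V\<^esub>f\<in>F. c f \<odot>\<^bsub>V\<^esub> v f)"
        using gen by blast
      define a where "a = c \<circ> inv_into F v"
      have av: "a (v f) = c f" if "f \<in> F" for f using inj that by (simp add: a_def)
      then have a: "a \<in> v ` F \<rightarrow> carrier K" using c by auto
      have "x = (\<Oplus>\<^bsub>V\<^esub>f\<in>F. a (v f) \<odot>\<^bsub>V\<^esub> v f)"
        unfolding c(2) by (rule M.finsum_cong') (use av c vc in \<open>auto simp: Pi_iff\<close>)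
      then have "x = lincomb a (v ` F)" using comb[OF a] by simp
      then show "x \<in> span (v ` F)" unfolding span_def using F a by blast
    qed
  qed
  ultimately have "basis (v ` F)" using vF by (simp add: basis_def)
  then have "dim = card (v ` F)" using F by (intro dim_basis) auto
  then show ?thesis using inj by (simp add: card_image)
qed

text \<open>
  The colon ideal \<open>(I : \<mm>)\<close>. The socle of \<open>R/I\<close> is its image \<open>(I : \<mm>)/I\<close>, and computing with
  elements of \<open>(I : \<mm>)\<close> avoids computing with cosets.
\<close>

definition socle_representatives :: "('a, 'b) ring_scheme \<Rightarrow> 'a set \<Rightarrow> 'a set" where
  "socle_representatives R I =
     {v \<in> carrier R. \<forall>r\<in>local_max_ideal R. r \<otimes>\<^bsub>R\<^esub> v \<in> I}"

locale socle_of_quotient = cring R + I: ideal I R + M: maximalideal "local_max_ideal R" R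
  for R (structure) and I
begin

abbreviation \<mm> where "\<mm> \<equiv> local_max_ideal R"
abbreviation Soc where "Soc \<equiv> socle_representatives R I"

lemma coset_eq_iff:
  assumes "a \<in> carrier R" "b \<in> carrier R"
  shows "I +> a = I +> b \<longleftrightarrow> a \<ominus> b \<in> I"
  using quotient_eq_iff_same_a_r_cos[OF I.is_ideal] assms by simp

lemma coset_eq_self_iff: "v \<in> carrier R \<Longrightarrow> I +> v = I \<longleftrightarrow> v \<in> I"
  using I.a_rcos_const I.a_rcos_self by blast

lemma socle_carrier: "carrier (socle_module R I) = (\<lambda>v. I +> v) ` Soc"
proof -
  have "r \<in> \<mm> \<Longrightarrow> r \<in> carrier R" for r by (simp add: local_max_ideal_def)
  then have "(\<forall>r\<in>\<mm>. (I +> r) \<otimes>\<^bsub>R Quot I\<^esub> (I +> v) = \<zero>\<^bsub>R Quot I\<^esub>) \<longleftrightarrow> (\<forall>r\<in>\<mm>. r \<otimes> v \<in> I)"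
    if "v \<in> carrier R" for v
    using that by (simp add: FactRing_def I.rcoset_mult_add coset_eq_self_iff)
  then show ?thesis
    unfolding socle_module_def socle_representatives_def
    by (auto simp: FactRing_def A_RCOSETS_defs a_r_coset_def[symmetric])
qed

lemma SocD: "v \<in> Soc \<Longrightarrow> v \<in> carrier R" "v \<in> Soc \<Longrightarrow> r \<in> \<mm> \<Longrightarrow> r \<otimes> v \<in> I"
  unfolding socle_representatives_def by auto

lemma Soc_ideal: "ideal Soc R"
proof (rule idealI[OF ring_axioms])
  have m: "r \<in> \<mm> \<Longrightarrow> r \<in> carrier R" for r by (simp add: local_max_ideal_def)
  show "subgroup Soc (add_monoid R)"
  proof (rule add.subgroupI)
    show "Soc \<subseteq> carrier R" using SocD(1) by blast
    have "\<zero> \<in> Soc" using m by (simp add: socle_representatives_def)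
    then show "Soc \<noteq> {}" by blast
    show "\<ominus> a \<in> Soc" if "a \<in> Soc" for a
      using that m by (simp add: socle_representatives_def r_minus I.a_inv_closed)
    show "a \<oplus> b \<in> Soc" if "a \<in> Soc" "b \<in> Soc" for a b
      using that m by (simp add: socle_representatives_def r_distr I.a_closed)
  qed
  show "x \<otimes> a \<in> Soc" if "a \<in> Soc" "x \<in> carrier R" for a x
  proof -
    have "r \<otimes> (x \<otimes> a) \<in> I" if "r \<in> \<mm>" for r
    proof -
      have "r \<otimes> (x \<otimes> a) = x \<otimes> (r \<otimes> a)" using m[OF that] SocD(1)[OF \<open>a \<in> Soc\<close>] \<open>x \<in> _\<close>
        by (simp add: m_lcomm)
      then show ?thesis using SocD(2)[OF \<open>a \<in> Soc\<close> that] \<open>x \<in> _\<close> I.I_l_closed by simp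
    qed
    then show ?thesis using SocD(1)[OF that(1)] that(2) by (simp add: socle_representatives_def)
  qed
  then show "a \<otimes> x \<in> Soc" if "a \<in> Soc" "x \<in> carrier R" for a x
    using that SocD(1) m_comm by metis
qed

sublocale Soc: ideal Soc R by (rule Soc_ideal)

lemma socle_add:
  assumes "v \<in> carrier R" "w \<in> carrier R"
  shows "(I +> v) \<oplus>\<^bsub>socle_module R I\<^esub> (I +> w) = I +> (v \<oplus> w)"
  using I.a_rcos_sum[OF assms] by (simp add: socle_module_def FactRing_def)

lemma socle_zero: "\<zero>\<^bsub>socle_module R I\<^esub> = I +> \<zero>"
  using I.a_rcos_const[OF I.zero_closed] by (simp add: socle_module_def FactRing_def)

text \<open>
  The scalar \<open>\<mm> + a\<close> acts through any representative: changing \<open>a\<close> by \<open>h \<in> \<mm>\<close> changes \<open>a v\<close> by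
  \<open>h v\<close>, which lies in \<open>I\<close> because \<open>v\<close> is in the colon ideal. So the union in the definition of
  the scalar multiplication is a union of copies of one coset.
\<close>

lemma socle_smult:
  assumes a: "a \<in> carrier R" and v: "v \<in> Soc"
  shows "(\<mm> +> a) \<odot>\<^bsub>socle_module R I\<^esub> (I +> v) = I +> (a \<otimes> v)"
proof -
  have vc: "v \<in> carrier R" using SocD v by blast
  have eq: "I +> a' \<otimes> v' = I +> a \<otimes> v" if a': "a' \<in> \<mm> +> a" and v': "v' \<in> I +> v" for a' v'
  proof -
    obtain h where h: "h \<in> \<mm>" "a' = h \<oplus> a" using a' by (auto simp: a_r_coset_def r_coset_def)
    obtain i where i: "i \<in> I" "v' = i \<oplus> v" using v' by (auto simp: a_r_coset_def r_coset_def)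
    have c: "h \<in> carrier R" "i \<in> carrier R" "a' \<in> carrier R"
      using h i I.a_Hcarr M.a_Hcarr a by auto
    have "a' \<otimes> v' \<ominus> a \<otimes> v = a' \<otimes> i \<oplus> h \<otimes> v"
      using c a vc unfolding h i by algebra
    also have "\<dots> \<in> I" using c i(1) SocD(2)[OF v h(1)] by (simp add: I.I_l_closed I.a_closed)
    finally show ?thesis using c i vc a by (subst coset_eq_iff) auto
  qed
  have "rcoset_mult R I (\<mm> +> a) (I +> v) = (\<Union>a'\<in>\<mm> +> a. \<Union>v'\<in>I +> v. I +> (a \<otimes> v))"
    unfolding rcoset_mult_def by (intro SUP_cong refl eq)
  also have "\<dots> = I +> (a \<otimes> v)"
    using M.a_rcos_self[OF a] I.a_rcos_self[OF vc] by blast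
  finally show ?thesis by (simp add: socle_module_def)
qed

lemma residue_field_carrier: "carrier (R Quot \<mm>) = (\<lambda>a. \<mm> +> a) ` carrier R"
  by (auto simp: FactRing_def A_RCOSETS_defs a_r_coset_def[symmetric])

lemma socle_vectorspace: "vectorspace (R Quot \<mm>) (socle_module R I)"
proof -
  let ?K = "R Quot \<mm>" and ?V = "socle_module R I"
  note [simp] = socle_carrier socle_add socle_zero socle_smult residue_field_carrier SocD(1)
    Soc.a_closed Soc.I_l_closed Soc.zero_closed
  have field: "field ?K" by (rule M.quotient_is_field) (rule is_cring)
  have add: "(\<mm> +> a) \<oplus>\<^bsub>?K\<^esub> (\<mm> +> b) = \<mm> +> (a \<oplus> b)"
    and mult: "(\<mm> +> a) \<otimes>\<^bsub>?K\<^esub> (\<mm> +> b) = \<mm> +> (a \<otimes> b)"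
    if "a \<in> carrier R" "b \<in> carrier R" for a b
    using that by (simp_all add: FactRing_def M.a_rcos_sum M.rcoset_mult_add)
  have one: "\<one>\<^bsub>?K\<^esub> = \<mm> +> \<one>" by (simp add: FactRing_def)
  have V: "\<exists>v\<in>Soc. x = I +> v" if "x \<in> carrier ?V" for x using that by auto
  have VI: "I +> v \<in> carrier ?V" if "v \<in> Soc" for v using that by simp
  have K: "\<exists>a\<in>carrier R. x = \<mm> +> a" if "x \<in> carrier ?K" for x using that by auto
  have ab: "abelian_group ?V"
  proof (rule abelian_groupI)
    show "\<zero>\<^bsub>?V\<^esub> \<in> carrier ?V" by simp
  next
    fix x assume "x \<in> carrier ?V"
    then obtain v where v: "v \<in> Soc" "x = I +> v" using V by blast
    show "\<zero>\<^bsub>?V\<^esub> \<oplus>\<^bsub>?V\<^esub> x = x" using v by simp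
    have "(I +> (\<ominus> v)) \<oplus>\<^bsub>?V\<^esub> x = \<zero>\<^bsub>?V\<^esub>" "\<ominus> v \<in> Soc"
      using v by (simp_all add: l_neg Soc.a_inv_closed)
    then show "\<exists>y\<in>carrier ?V. y \<oplus>\<^bsub>?V\<^esub> x = \<zero>\<^bsub>?V\<^esub>" using VI by blast
    fix y assume "y \<in> carrier ?V"
    then obtain w where w: "w \<in> Soc" "y = I +> w" using V by blast
    show "x \<oplus>\<^bsub>?V\<^esub> y \<in> carrier ?V" "x \<oplus>\<^bsub>?V\<^esub> y = y \<oplus>\<^bsub>?V\<^esub> x"
      using v w by (simp_all add: a_comm)
    fix z assume "z \<in> carrier ?V"
    then obtain u where u: "u \<in> Soc" "z = I +> u" using V by blast
    show "x \<oplus>\<^bsub>?V\<^esub> y \<oplus>\<^bsub>?V\<^esub> z = x \<oplus>\<^bsub>?V\<^esub> (y \<oplus>\<^bsub>?V\<^esub> z)" using v w u by (simp add: a_assoc)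
  qed
  have "cring ?K" using field by (simp add: field_def domain_def)
  then have "module ?K ?V"
  proof (rule moduleI[OF _ ab])
    fix x assume "x \<in> carrier ?V"
    then obtain v where v: "v \<in> Soc" "x = I +> v" using V by blast
    show "\<one>\<^bsub>?K\<^esub> \<odot>\<^bsub>?V\<^esub> x = x" using v by (simp add: one)
    fix k assume "k \<in> carrier ?K"
    then obtain a where a: "a \<in> carrier R" "k = \<mm> +> a" using K by blast
    show "k \<odot>\<^bsub>?V\<^esub> x \<in> carrier ?V" using v a by simp
    { fix y assume "y \<in> carrier ?V"
      then obtain w where w: "w \<in> Soc" "y = I +> w" using V by blast
      show "k \<odot>\<^bsub>?V\<^esub> (x \<oplus>\<^bsub>?V\<^esub> y) = k \<odot>\<^bsub>?V\<^esub> x \<oplus>\<^bsub>?V\<^esub> k \<odot>\<^bsub>?V\<^esub> y"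
        using v w a by (simp add: r_distr) }
    fix l assume "l \<in> carrier ?K"
    then obtain b where b: "b \<in> carrier R" "l = \<mm> +> b" using K by blast
    show "(k \<oplus>\<^bsub>?K\<^esub> l) \<odot>\<^bsub>?V\<^esub> x = k \<odot>\<^bsub>?V\<^esub> x \<oplus>\<^bsub>?V\<^esub> l \<odot>\<^bsub>?V\<^esub> x"
      using v a b by (simp add: add l_distr)
    show "(k \<otimes>\<^bsub>?K\<^esub> l) \<odot>\<^bsub>?V\<^esub> x = k \<odot>\<^bsub>?V\<^esub> (l \<odot>\<^bsub>?V\<^esub> x)"
      using v a b by (simp add: mult m_assoc)
  qed
  then show ?thesis using field by (rule vectorspace.intro)
qed

text \<open>
  The form in which the dimension of the socle is computed below: coefficients are ring elements
  instead of residue classes, independence is relative to \<open>\<mm>\<close> and \<open>I\<close>, and spanning is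
  spanning modulo \<open>I\<close>.
\<close>

lemma socle_dim:
  assumes F: "finite F" and b: "b \<in> F \<rightarrow> Soc"
    and indep: "\<And>c f. c \<in> F \<rightarrow> carrier R \<Longrightarrow> (\<Oplus>f\<in>F. c f \<otimes> b f) \<in> I \<Longrightarrow> f \<in> F \<Longrightarrow> c f \<in> \<mm>"
    and gen: "\<And>v. v \<in> Soc \<Longrightarrow> \<exists>c\<in>F \<rightarrow> carrier R. v \<ominus> (\<Oplus>f\<in>F. c f \<otimes> b f) \<in> I"
  shows "vectorspace.dim (R Quot \<mm>) (socle_module R I) = card F"
proof (rule vectorspace.dim_of_basis_family[OF socle_vectorspace F])
  let ?K = "R Quot \<mm>" and ?V = "socle_module R I"
  have bS: "b f \<in> Soc" if "f \<in> F" for f using b that by (rule funcset_mem)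
  have bR: "b f \<in> carrier R" if "f \<in> F" for f using bS[OF that] by (rule SocD(1))
  have sumc: "(\<Oplus>f\<in>F. c f \<otimes> b f) \<in> carrier R" if "c \<in> F \<rightarrow> carrier R" for c
    using that bR by (intro finsum_closed) auto
  have V: "abelian_monoid ?V"
    using socle_vectorspace by (simp add: vectorspace_def module_def abelian_group_def)
  have comb: "(\<Oplus>\<^bsub>?V\<^esub>f\<in>F. k f \<odot>\<^bsub>?V\<^esub> (I +> b f)) = I +> (\<Oplus>f\<in>F. c f \<otimes> b f)"
    if c: "c \<in> F \<rightarrow> carrier R" and k: "\<And>f. f \<in> F \<Longrightarrow> k f = \<mm> +> c f" for c k
    using F c bR bS k
  proof (induction F)
    case empty
    then show ?case by (simp add: socle_zero abelian_monoid.finsum_empty[OF V])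
  next
    case (insert f F)
    have sm: "k g \<odot>\<^bsub>?V\<^esub> (I +> b g) = I +> (c g \<otimes> b g)" "c g \<otimes> b g \<in> Soc" "c g \<otimes> b g \<in> carrier R"
      if "g \<in> insert f F" for g
      using insert.prems that by (auto simp: socle_smult Soc.I_l_closed Pi_iff)
    then have mem: "k g \<odot>\<^bsub>?V\<^esub> (I +> b g) \<in> carrier ?V" if "g \<in> insert f F" for g
      using that by (simp add: socle_carrier)
    have s: "(\<Oplus>f\<in>F. c f \<otimes> b f) \<in> carrier R" using sm(3) by (intro finsum_closed) auto
    have "(\<Oplus>\<^bsub>?V\<^esub>f\<in>insert f F. k f \<odot>\<^bsub>?V\<^esub> (I +> b f))
        = k f \<odot>\<^bsub>?V\<^esub> (I +> b f) \<oplus>\<^bsub>?V\<^esub> (\<Oplus>\<^bsub>?V\<^esub>f\<in>F. k f \<odot>\<^bsub>?V\<^esub> (I +> b f))"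
      using insert.hyps mem by (intro abelian_monoid.finsum_insert[OF V]) auto
    also have "\<dots> = (I +> (c f \<otimes> b f)) \<oplus>\<^bsub>?V\<^esub> (I +> (\<Oplus>f\<in>F. c f \<otimes> b f))"
      using insert.IH insert.prems sm(1) by simp
    also have "\<dots> = I +> (\<Oplus>f\<in>insert f F. c f \<otimes> b f)"
      using insert.hyps sm(3) s by (simp add: socle_add finsum_insert Pi_iff)
    finally show ?case .
  qed
  show "(\<lambda>f. I +> b f) \<in> F \<rightarrow> carrier ?V" using bS by (auto simp: socle_carrier)
  show "k f = \<zero>\<^bsub>?K\<^esub>"
    if k: "k \<in> F \<rightarrow> carrier ?K" and 0: "(\<Oplus>\<^bsub>?V\<^esub>f\<in>F. k f \<odot>\<^bsub>?V\<^esub> (I +> b f)) = \<zero>\<^bsub>?V\<^esub>" and f: "f \<in> F" for k f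
  proof -
    have "\<forall>f\<in>F. \<exists>r\<in>carrier R. k f = \<mm> +> r" using k by (auto simp: residue_field_carrier)
    then obtain c where c: "c \<in> F \<rightarrow> carrier R" "\<And>f. f \<in> F \<Longrightarrow> k f = \<mm> +> c f"
      by (metis Pi_I)
    have "I +> (\<Oplus>f\<in>F. c f \<otimes> b f) = I"
      using 0 comb[OF c] I.a_rcos_const[OF I.zero_closed] by (simp add: socle_zero)
    then have "(\<Oplus>f\<in>F. c f \<otimes> b f) \<in> I" using coset_eq_self_iff sumc c(1) by blast
    then have "c f \<in> \<mm>" using indep c(1) f by blast
    then show ?thesis using M.a_rcos_const c(2) f by (simp add: FactRing_def)
  qed
  show "\<exists>k\<in>F \<rightarrow> carrier ?K. x = (\<Oplus>\<^bsub>?V\<^esub>f\<in>F. k f \<odot>\<^bsub>?V\<^esub> (I +> b f))" if "x \<in> carrier ?V" for x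
  proof -
    obtain v where v: "v \<in> Soc" "x = I +> v" using \<open>x \<in> carrier ?V\<close> by (auto simp: socle_carrier)
    obtain c where c: "c \<in> F \<rightarrow> carrier R" "v \<ominus> (\<Oplus>f\<in>F. c f \<otimes> b f) \<in> I" using gen v by blast
    have "x = (\<Oplus>\<^bsub>?V\<^esub>f\<in>F. (\<mm> +> c f) \<odot>\<^bsub>?V\<^esub> (I +> b f))"
      using c v comb[OF c(1)] coset_eq_iff[OF SocD(1) sumc] by simp
    then show ?thesis using c(1)
      by (intro bexI[of _ "\<lambda>f. \<mm> +> c f"]) (auto simp: residue_field_carrier)
  qed
qed

end

section \<open>Numerical semigroups and their pseudo-Frobenius numbers\<close>

locale nsemigroup =
  fixes S :: "nat set"
  assumes S: "numerical_semigroup S"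
begin

lemma zero_mem: "0 \<in> S" and add_mem: "a \<in> S \<Longrightarrow> b \<in> S \<Longrightarrow> a + b \<in> S"
  using S unfolding numerical_semigroup_def by auto

lemma conductor: obtains c where "c > 0" "\<And>n. n \<ge> c \<Longrightarrow> n \<in> S"
proof -
  have "finite (UNIV - S)" using S unfolding numerical_semigroup_def by blast
  then obtain b where "\<forall>n\<in>UNIV - S. n \<le> b" using finite_nat_set_iff_bounded_le by blast
  then show thesis using that[of "Suc b"] by force
qed

text \<open>
  If \<open>-m\<close> with \<open>m \<ge> 2\<close> translated all positive elements of \<open>S\<close> into \<open>S\<close>, then subtracting \<open>m\<close> could be
  repeated until \<open>0\<close> is reached, so \<open>m\<close> would divide every element of \<open>S\<close>; but \<open>S\<close> contains
  two consecutive numbers.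
\<close>

lemma translate_into_ge_minus_one:
  assumes f: "\<And>s. s \<in> S - {0} \<Longrightarrow> f + int s \<in> int ` S"
  shows "f \<ge> -1"
proof (rule ccontr)
  assume "\<not> f \<ge> -1"
  define m where "m = nat (- f)"
  have m: "m \<ge> 2" "f = - int m" using \<open>\<not> f \<ge> -1\<close> by (auto simp: m_def)
  have step: "m \<le> s \<and> s - m \<in> S" if s: "s \<in> S - {0}" for s
  proof -
    obtain t where t: "t \<in> S" "f + int s = int t" using f[OF s] by blast
    then have "s = t + m" using m(2) by linarith
    then show ?thesis using t by simp
  qed
  have "m dvd s" if "s \<in> S" for s
    using that
  proof (induction s rule: less_induct)
    case (less s)
    show ?case
    proof (cases "s = 0")
      case False
      then have "m \<le> s" "s - m \<in> S" using step less.prems by auto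
      then have "m dvd s - m" using less.IH m False by simp
      then show ?thesis using \<open>m \<le> s\<close> by (simp add: dvd_minus_self)
    qed simp
  qed
  moreover obtain c where "\<And>n. n \<ge> c \<Longrightarrow> n \<in> S" using conductor by blast
  ultimately have "m dvd c" "m dvd c + 1" by simp_all
  then have "m dvd 1" by (metis dvd_add_right_iff)
  then show False using m by simp
qed

lemma PF_ge_minus_one: "f \<in> PF S \<Longrightarrow> f \<ge> -1"
  by (rule translate_into_ge_minus_one) (simp add: PF_def)

lemma finite_PF: "finite (PF S)"
proof (rule finite_subset)
  show "PF S \<subseteq> insert (-1) (int ` (UNIV - S))"
  proof
    fix f assume f: "f \<in> PF S"
    then have "f = -1 \<or> f = int (nat f)" using PF_ge_minus_one[OF f] by auto
    moreover have "f \<notin> int ` S" using f by (simp add: PF_def)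
    ultimately show "f \<in> insert (-1) (int ` (UNIV - S))" by blast
  qed
  show "finite (insert (-1) (int ` (UNIV - S)))" using S by (simp add: numerical_semigroup_def)
qed

text \<open>
  The exponents of \<open>t (R : \<mm>)\<close>, where \<open>(R : \<mm>)\<close> is the dual of the maximal ideal of \<open>R = k[[S]]\<close> in
  the fraction field. The factor \<open>t\<close> makes all exponents nonnegative, as those of \<open>(R : \<mm>)\<close> are
  at least \<open>-1\<close>; so no Laurent series are needed. The truncated subtraction is harmless, as \<open>s > 0\<close>.
\<close>

definition shifted_dual_exponents :: "nat set" where
  "shifted_dual_exponents = {n. \<forall>s\<in>S - {0}. n + s - 1 \<in> S}"

lemma shifted_dual_exponents_iff: "n \<in> shifted_dual_exponents \<longleftrightarrow> int n - 1 \<in> int ` S \<union> PF S"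
proof -
  have "int n - 1 + int s \<in> int ` S \<longleftrightarrow> n + s - 1 \<in> S" if "s \<in> S - {0}" for s
  proof -
    have "int n - 1 + int s = int (n + s - 1)" using that by auto
    then show ?thesis by (auto simp only: inj_image_mem_iff inj_on_of_nat)
  qed
  then have 1: "n \<in> shifted_dual_exponents \<longleftrightarrow> (\<forall>s\<in>S - {0}. int n - 1 + int s \<in> int ` S)"
    unfolding shifted_dual_exponents_def by auto
  have "int n - 1 + int s \<in> int ` S" if "int n - 1 \<in> int ` S" "s \<in> S" for s
  proof -
    obtain t where "t \<in> S" "int n - 1 = int t" using \<open>int n - 1 \<in> int ` S\<close> by blast
    then have "int n - 1 + int s = int (t + s)" "t + s \<in> S" using add_mem that by auto
    then show ?thesis by (metis imageI)
  qed
  then show ?thesis unfolding 1 PF_def by blast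
qed

end

lemma numerical_semigroup_eq_UNIV_iff:
  assumes "numerical_semigroup H"
  shows "H = UNIV \<longleftrightarrow> 1 \<in> H"
proof
  interpret nsemigroup H by unfold_locales (rule assms)
  assume 1: "1 \<in> H"
  have "n \<in> H" for n by (induction n) (use zero_mem add_mem[OF 1] in auto)
  then show "H = UNIV" by blast
qed simp

text \<open>
  A pseudo-Frobenius number is at least \<open>-1\<close>, so it can cancel only the element \<open>1\<close>. This is what
  turns membership in \<open>E \<union> {0}\<close> into membership in \<open>E\<close> below.
\<close>

lemma PF_plus_mem_nonzero:
  assumes H: "numerical_semigroup H" "H \<noteq> UNIV" and f: "f \<in> PF H" and s: "s \<in> H - {0}"
  shows "f + int s \<in> int ` (H - {0})"
proof -
  interpret nsemigroup H by unfold_locales (rule H)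
  have "s \<noteq> 1" using H s numerical_semigroup_eq_UNIV_iff by auto
  then have "f + int s > 0" using PF_ge_minus_one[OF f] s by auto
  moreover obtain t where "t \<in> H" "f + int s = int t" using f s by (auto simp: PF_def)
  ultimately show ?thesis by auto
qed

section \<open>The semigroup ring as a ring of power series\<close>

lemma finite_bounded_multisets: "finite {\<alpha>. set_mset \<alpha> \<subseteq> A \<and> size \<alpha> \<le> n}" if "finite A"
proof (rule finite_subset)
  show "{\<alpha>. set_mset \<alpha> \<subseteq> A \<and> size \<alpha> \<le> n} \<subseteq> mset ` {xs. set xs \<subseteq> A \<and> length xs \<le> n}"
  proof
    fix \<alpha> assume "\<alpha> \<in> {\<alpha>. set_mset \<alpha> \<subseteq> A \<and> size \<alpha> \<le> n}"
    moreover obtain xs where "\<alpha> = mset xs" using ex_mset by metis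
    ultimately show "\<alpha> \<in> mset ` {xs. set xs \<subseteq> A \<and> length xs \<le> n}" by auto
  qed
  show "finite (mset ` {xs. set xs \<subseteq> A \<and> length xs \<le> n})"
    using finite_lists_length_le[OF that] by (rule finite_imageI)
qed

lemma finite_monomials_of_degree:
  assumes "0 \<notin> G"
  shows "finite {\<alpha>. set_mset \<alpha> \<subseteq> G \<and> sum_mset \<alpha> = (n::nat)}"
proof (rule finite_subset[OF _ finite_bounded_multisets[of "{..n}" n]])
  have "size \<alpha> \<le> sum_mset \<alpha>" if "set_mset \<alpha> \<subseteq> G" for \<alpha>
    using that
  proof (induction \<alpha>)
    case (add x \<alpha>)
    then have "x > 0" using assms by (intro gr0I) auto
    then show ?case using add by auto
  qed simp
  moreover have "x \<le> sum_mset \<alpha>" if "x \<in># \<alpha>" for x and \<alpha> :: "nat multiset"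
    using that by (metis insert_DiffM le_add1 sum_mset.add_mset)
  ultimately show "{\<alpha>. set_mset \<alpha> \<subseteq> G \<and> sum_mset \<alpha> = n} \<subseteq> {\<alpha>. set_mset \<alpha> \<subseteq> {..n} \<and> size \<alpha> \<le> n}"
    by blast
qed simp

text \<open>
  The substitution \<open>x\<^sub>g \<mapsto> t\<^sup>g\<close> hits every power series with exponents in the monoid generated by \<open>G\<close>:
  it suffices to pick one monomial \<open>\<mu> n\<close> of each degree \<open>n\<close> and to give it the whole coefficient
  of \<open>t\<^sup>n\<close>.
\<close>

lemma power_series_in_monomials_eq:
  assumes "0 \<notin> G"
  shows "power_series_in_monomials G =
    {f :: 'k::comm_ring_1 fps. \<forall>n. f $ n \<noteq> 0 \<longrightarrow> n \<in> submonoid_generated G}"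
proof (intro equalityI subsetI CollectI allI impI)
  fix f :: "'k fps" and n assume "f \<in> power_series_in_monomials G" "f $ n \<noteq> 0"
  then obtain c where "(\<Sum>\<alpha> | set_mset \<alpha> \<subseteq> G \<and> sum_mset \<alpha> = n. c \<alpha> :: 'k) \<noteq> 0"
    unfolding power_series_in_monomials_def by auto
  then have "{\<alpha>. set_mset \<alpha> \<subseteq> G \<and> sum_mset \<alpha> = n} \<noteq> {}" by (metis sum.empty)
  then show "n \<in> submonoid_generated G" unfolding submonoid_generated_def by auto
next
  fix f :: "'k fps" assume "f \<in> {f. \<forall>n. f $ n \<noteq> 0 \<longrightarrow> n \<in> submonoid_generated G}"
  then have f: "f $ n \<noteq> 0 \<Longrightarrow> n \<in> submonoid_generated G" for n by blast
  define \<mu> where "\<mu> n = (SOME \<alpha>. set_mset \<alpha> \<subseteq> G \<and> sum_mset \<alpha> = n)" for n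
  have \<mu>: "set_mset (\<mu> n) \<subseteq> G \<and> sum_mset (\<mu> n) = n" if "n \<in> submonoid_generated G" for n
    using that unfolding \<mu>_def submonoid_generated_def
    by (intro someI_ex[of "\<lambda>\<alpha>. set_mset \<alpha> \<subseteq> G \<and> sum_mset \<alpha> = n"]) auto
  define c where "c \<alpha> = (if \<alpha> = \<mu> (sum_mset \<alpha>) then f $ sum_mset \<alpha> else 0)" for \<alpha>
  have "f $ n = (\<Sum>\<alpha> | set_mset \<alpha> \<subseteq> G \<and> sum_mset \<alpha> = n. c \<alpha>)" for n
  proof -
    have "(\<Sum>\<alpha> | set_mset \<alpha> \<subseteq> G \<and> sum_mset \<alpha> = n. c \<alpha>)
        = (\<Sum>\<alpha> | set_mset \<alpha> \<subseteq> G \<and> sum_mset \<alpha> = n. if \<alpha> = \<mu> n then f $ n else 0)"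
      by (rule sum.cong) (auto simp: c_def)
    also have "\<dots> = (if set_mset (\<mu> n) \<subseteq> G \<and> sum_mset (\<mu> n) = n then f $ n else 0)"
      using finite_monomials_of_degree[OF assms, of n] by (simp add: sum.delta)
    also have "\<dots> = f $ n" using f \<mu> by auto
    finally show ?thesis by simp
  qed
  then have "f = Abs_fps (\<lambda>n. \<Sum>\<alpha> | set_mset \<alpha> \<subseteq> G \<and> sum_mset \<alpha> = n. c \<alpha>)"
    by (simp add: fps_eq_iff)
  then show "f \<in> power_series_in_monomials G" unfolding power_series_in_monomials_def by blast
qed

lemma mem_semigroup_ring:
  assumes "numerical_semigroup S"
  shows "f \<in> carrier (semigroup_ring TYPE('k::field) S) \<longleftrightarrow> (\<forall>n. f $ n \<noteq> 0 \<longrightarrow> n \<in> S)"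
proof -
  let ?G = "minimal_generators S"
  have "minimally_generates ?G S" "0 \<notin> ?G" using minimal_generators_eq[OF assms] by auto
  then show ?thesis
    by (simp add: semigroup_ring_def power_series_in_monomials_eq minimally_generates_def)
qed

locale semigroup_ring_over = nsemigroup S for S +
  fixes R :: "('k::field) fps ring"
  defines R_def: "R \<equiv> semigroup_ring TYPE('k) S"
begin

lemma mem_R: "f \<in> carrier R \<longleftrightarrow> (\<forall>n. f $ n \<noteq> 0 \<longrightarrow> n \<in> S)"
  unfolding R_def using S by (rule mem_semigroup_ring)

lemma R_ops [simp]: "mult R = (*)" "one R = 1" "zero R = 0" "add R = (+)"
  by (simp_all add: R_def semigroup_ring_def)

lemma R_0: "0 \<in> carrier R" and R_1: "1 \<in> carrier R"
  and R_add: "f \<in> carrier R \<Longrightarrow> g \<in> carrier R \<Longrightarrow> f + g \<in> carrier R"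
  and R_uminus: "f \<in> carrier R \<Longrightarrow> - f \<in> carrier R"
  by (auto simp: mem_R zero_mem) (metis add.right_neutral add_0)

lemma mult_supported:
  fixes f g :: "'k fps"
  assumes "\<And>i j. f $ i \<noteq> 0 \<Longrightarrow> g $ j \<noteq> 0 \<Longrightarrow> i + j \<in> A" "(f * g) $ n \<noteq> 0"
  shows "n \<in> A"
proof -
  have "(\<Sum>i=0..n. f $ i * g $ (n - i)) \<noteq> 0" using assms(2) by (simp add: fps_mult_nth)
  then obtain i where i: "i \<in> {0..n}" "f $ i * g $ (n - i) \<noteq> 0" by (rule sum.not_neutral_contains_not_neutral)
  then have "i + (n - i) \<in> A" using assms(1) by (metis mult_eq_0_iff)
  then show ?thesis using i by simp
qed

lemma R_mult: "f * g \<in> carrier R" if "f \<in> carrier R" "g \<in> carrier R"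
  unfolding mem_R
proof (intro allI impI)
  fix n assume "(f * g) $ n \<noteq> 0"
  then show "n \<in> S" by (rule mult_supported[rotated]) (use that in \<open>simp add: mem_R add_mem\<close>)
qed

lemma R_cring: "cring R"
proof (rule cringI)
  show "abelian_group R"
  proof (rule abelian_groupI)
    fix x assume "x \<in> carrier R"
    then show "\<exists>y\<in>carrier R. y \<oplus>\<^bsub>R\<^esub> x = \<zero>\<^bsub>R\<^esub>" by (intro bexI[of _ "- x"]) (auto simp: R_uminus)
  qed (auto simp: R_0 R_add)
  show "comm_monoid R" by (rule comm_monoidI) (auto simp: R_1 R_mult)
qed (simp add: distrib_right)

interpretation R: cring R by (rule R_cring)

lemma R_finsum: "finsum R h F = sum h F" if "h \<in> F \<rightarrow> carrier R"
proof (cases "finite F")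
  case True
  then show ?thesis using that
  proof (induction F)
    case (insert a F)
    then show ?case by (subst R.finsum_insert) auto
  qed (simp add: R.finsum_empty)
qed (simp add: R.finsum_infinite)

lemma R_minus: "f \<ominus>\<^bsub>R\<^esub> g = f - g" if "f \<in> carrier R" "g \<in> carrier R"
proof -
  have "\<ominus>\<^bsub>R\<^esub> g = - g" by (rule R.minus_equality) (simp_all add: that R_uminus)
  then show ?thesis by (simp add: a_minus_def)
qed

lemma X_power_in_R: "s \<in> S \<Longrightarrow> fps_X ^ s \<in> carrier R"
  by (auto simp: mem_R fps_X_power_nth split: if_splits)

lemma const_in_R: "fps_const a \<in> carrier R"
  by (auto simp: mem_R zero_mem split: if_splits)

text \<open>
  In \<open>f \<cdot> (1/f) = 1\<close> the coefficient of \<open>t\<^sup>n\<close> for the least exponent \<open>n \<notin> S\<close> of \<open>1/f\<close> reduces to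
  \<open>f\<^sub>0\<close> times that of \<open>1/f\<close>: in every other product the two exponents would lie in \<open>S\<close> and add up to \<open>n\<close>.
\<close>

lemma inverse_in_R:
  assumes f: "f \<in> carrier R" "f $ 0 \<noteq> 0"
  shows "inverse f \<in> carrier R"
  unfolding mem_R
proof (intro allI impI, rule ccontr)
  fix n assume "inverse f $ n \<noteq> 0" "n \<notin> S"
  then show False
  proof (induction n rule: less_induct)
    case (less n)
    have n: "n \<noteq> 0" using less.prems zero_mem by metis
    have "0 = (f * inverse f) $ n" using f(2) n by (simp add: inverse_mult_eq_1')
    also have "\<dots> = (\<Sum>i=0..n. f $ i * inverse f $ (n - i))" by (simp add: fps_mult_nth)
    also have "\<dots> = (\<Sum>i=0..n. if i = 0 then f $ 0 * inverse f $ n else 0)"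
    proof (rule sum.cong[OF refl])
      fix i assume i: "i \<in> {0..n}"
      have "f $ i * inverse f $ (n - i) = 0" if "i \<noteq> 0"
      proof (rule ccontr)
        assume "f $ i * inverse f $ (n - i) \<noteq> 0"
        then have "i \<in> S" "n - i \<in> S" using f(1) less.IH[of "n - i"] that i by (auto simp: mem_R)
        then have "i + (n - i) \<in> S" by (rule add_mem)
        then show False using less.prems i by simp
      qed
      then show "f $ i * inverse f $ (n - i) = (if i = 0 then f $ 0 * inverse f $ n else 0)" by simp
    qed
    also have "\<dots> = f $ 0 * inverse f $ n" by simp
    finally show False using f(2) less.prems by simp
  qed
qed

lemma maximal_ideal_R: "local_max_ideal R = {f \<in> carrier R. f $ 0 = 0}"
proof -
  have "f \<in> Units R \<longleftrightarrow> f $ 0 \<noteq> 0" if f: "f \<in> carrier R" for f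
  proof
    assume "f \<in> Units R"
    then obtain g where "f * g = 1" unfolding Units_def by auto
    then have "f $ 0 * g $ 0 = 1" by (metis fps_mult_nth_0 fps_one_nth)
    then show "f $ 0 \<noteq> 0" by auto
  next
    assume "f $ 0 \<noteq> 0"
    then show "f \<in> Units R"
      using f inverse_in_R[OF f] unfolding Units_def
      by (auto intro!: bexI[of _ "inverse f"] simp: inverse_mult_eq_1 inverse_mult_eq_1')
  qed
  then show ?thesis unfolding local_max_ideal_def by auto
qed

lemma maximalideal_R: "maximalideal (local_max_ideal R) R"
proof (rule maximalidealI)
  show "ideal (local_max_ideal R) R"
  proof (rule idealI[OF R.ring_axioms])
    show "subgroup (local_max_ideal R) (add_monoid R)"
    proof (rule R.add.subgroupI)
      have "0 \<in> local_max_ideal R" by (simp add: maximal_ideal_R R_0)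
      then show "local_max_ideal R \<noteq> {}" by blast
      show "\<ominus>\<^bsub>R\<^esub> a \<in> local_max_ideal R" if "a \<in> local_max_ideal R" for a
      proof -
        have "\<ominus>\<^bsub>R\<^esub> a = - a" using R_minus[of 0 a] that R_0 by (simp add: maximal_ideal_R a_minus_def)
        then show ?thesis using that by (simp add: maximal_ideal_R R_uminus)
      qed
    qed (auto simp: maximal_ideal_R R_add)
  qed (auto simp: maximal_ideal_R R_mult)
  have "1 \<notin> local_max_ideal R" by (simp add: maximal_ideal_R)
  then show "carrier R \<noteq> local_max_ideal R" using R_1 by metis
  fix J assume J: "ideal J R" "local_max_ideal R \<subseteq> J" "J \<subseteq> carrier R"
  show "J = local_max_ideal R \<or> J = carrier R"
  proof (cases "J = local_max_ideal R")
    case False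
    then obtain u where u: "u \<in> J" "u \<in> Units R" using J unfolding local_max_ideal_def by blast
    then have "inv\<^bsub>R\<^esub> u \<otimes>\<^bsub>R\<^esub> u \<in> J"
      using ideal.I_l_closed[OF J(1)] R.Units_inv_closed by blast
    then have "J = carrier R" using ideal.one_imp_carrier[OF J(1)] R.Units_l_inv[OF u(2)] by simp
    then show ?thesis by blast
  qed simp
qed

lemma Idl_empty: "Idl\<^bsub>R\<^esub> {} = {0}"
proof
  show "Idl\<^bsub>R\<^esub> {} \<subseteq> {0}" using R.genideal_minimal[OF R.zeroideal, of "{}"] by simp
  show "{0} \<subseteq> Idl\<^bsub>R\<^esub> {}"
    using additive_subgroup.zero_closed[OF ideal.axioms(1)[OF R.genideal_ideal[of "{}"]]] by simp
qed

lemma Idl_singleton: "x \<in> carrier R \<Longrightarrow> Idl\<^bsub>R\<^esub> {x} = {r * x | r. r \<in> carrier R}"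
  using R.cgenideal_eq_genideal[of x] by (simp add: cgenideal_def)

lemma regular_singleton_iff: "regular_sequence R [x] \<longleftrightarrow> x \<in> local_max_ideal R \<and> x \<noteq> 0"
proof -
  have "regular_sequence R [x] \<longleftrightarrow> x \<in> local_max_ideal R \<and> (\<forall>a\<in>carrier R. a * x = 0 \<longrightarrow> a = 0)"
    by (simp add: regular_sequence_def Idl_empty)
  then show ?thesis using R_1 by auto
qed

text \<open>
  The ring is one-dimensional: modulo a nonzero \<open>x\<close> every element of the maximal ideal is
  nilpotent. For \<open>n\<close> large, \<open>y\<^sup>n/x\<close> is a power series whose order reaches the conductor of \<open>S\<close>, so
  it lies in the ring.
\<close>

lemma power_in_Idl:
  assumes x: "x \<in> carrier R" "x \<noteq> 0" and y: "y $ 0 = 0"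
  shows "\<exists>n. y ^ n \<in> Idl\<^bsub>R\<^esub> {x}"
proof -
  obtain c where c: "c > 0" "\<And>n. n \<ge> c \<Longrightarrow> n \<in> S" using conductor by blast
  define n where "n = subdegree x + c"
  show ?thesis
  proof (cases "y ^ n = 0")
    case True
    moreover have "0 * x \<in> Idl\<^bsub>R\<^esub> {x}" using R_0 unfolding Idl_singleton[OF x(1)] by blast
    ultimately show ?thesis by (metis mult_zero_left)
  next
    case False
    have "subdegree (y ^ n) \<ge> n"
      using False startsby_zero_power_prefix[OF y, of n] by (intro subdegree_geI) auto
    then have "subdegree x \<le> subdegree (y ^ n)" unfolding n_def by linarith
    then have "x dvd y ^ n" by (subst fps_dvd_iff[OF x(2) False])
    then obtain q where q: "y ^ n = x * q" by blast
    then have "x * q \<noteq> 0" using False by simp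
    then have "subdegree (y ^ n) = subdegree x + subdegree q" unfolding q by simp
    then have "subdegree q \<ge> c" using \<open>subdegree (y ^ n) \<ge> n\<close> unfolding n_def by linarith
    then have "q \<in> carrier R" unfolding mem_R using c(2)
      by (metis le_trans not_le_imp_less nth_less_subdegree_zero)
    then have "y ^ n \<in> Idl\<^bsub>R\<^esub> {x}"
      unfolding Idl_singleton[OF x(1)] q by (auto simp: mult.commute)
    then show ?thesis by blast
  qed
qed

text \<open>
  If \<open>y\<close> were regular modulo \<open>x\<close>, then cancelling the factors of \<open>y\<^sup>n \<in> (x)\<close> one by one would
  give \<open>1 \<in> (x)\<close>.
\<close>

lemma not_regular_two: "\<not> regular_sequence R (x # y # zs)"
proof
  assume reg: "regular_sequence R (x # y # zs)"
  then have x: "x \<in> local_max_ideal R" and y: "y \<in> local_max_ideal R"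
    by (simp_all add: regular_sequence_def)
  have "\<forall>a\<in>carrier R. a * x = 0 \<longrightarrow> a = 0"
    using reg unfolding regular_sequence_def by (auto simp: Idl_empty dest!: spec[of _ 0])
  then have x0: "x \<noteq> 0" using R_1 by auto
  have xR: "x \<in> carrier R" and yR: "y \<in> carrier R" and xy0: "x $ 0 = 0" "y $ 0 = 0"
    using x y by (auto simp: maximal_ideal_R)
  have cancel: "a \<in> Idl\<^bsub>R\<^esub> {x}" if "a \<in> carrier R" "a * y \<in> Idl\<^bsub>R\<^esub> {x}" for a
    using reg that unfolding regular_sequence_def by (auto dest!: spec[of _ "Suc 0"])
  have pow: "y ^ k \<in> carrier R" for k by (induction k) (auto simp: R_1 R_mult yR)
  have "1 \<in> Idl\<^bsub>R\<^esub> {x}" if "y ^ k \<in> Idl\<^bsub>R\<^esub> {x}" for k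
    using that
  proof (induction k)
    case (Suc k)
    then show ?case using cancel[OF pow, of k] by (simp add: mult.commute)
  qed simp
  then have "1 \<in> Idl\<^bsub>R\<^esub> {x}" using power_in_Idl[OF xR x0 xy0(2)] by blast
  then obtain r where "1 = r * x" using xR by (auto simp: Idl_singleton)
  then have "(1 :: 'k) = r $ 0 * x $ 0" by (metis fps_mult_nth_0 fps_one_nth)
  then show False using xy0 by simp
qed

text \<open>
  Hence the sequence chosen in the definition of the type is a single nonzero element of the
  maximal ideal. As nothing more is known about that element, the socle has to be computed for all
  of them, and not just for a power of \<open>t\<close>.
\<close>

lemma maximal_regular_sequence_iff:
  "maximal_regular_sequence R xs \<longleftrightarrow> (\<exists>x\<in>local_max_ideal R - {0}. xs = [x])"
proof
  obtain c where c: "c > 0" "\<And>n. n \<ge> c \<Longrightarrow> n \<in> S" using conductor by blast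
  then have "regular_sequence R [fps_X ^ c]"
    by (simp add: regular_singleton_iff maximal_ideal_R X_power_in_R)
  moreover assume "maximal_regular_sequence R xs"
  ultimately have "xs \<noteq> []" "regular_sequence R xs"
    unfolding maximal_regular_sequence_def by (metis append_Nil)+
  then show "\<exists>x\<in>local_max_ideal R - {0}. xs = [x]"
    using not_regular_two by (cases xs rule: remdups_adj.cases) (auto simp: regular_singleton_iff)
next
  assume "\<exists>x\<in>local_max_ideal R - {0}. xs = [x]"
  then show "maximal_regular_sequence R xs"
    by (auto simp: maximal_regular_sequence_def regular_singleton_iff not_regular_two)
qed

end

section \<open>The type of a semigroup ring\<close>

context semigroup_ring_over
begin

interpretation R: cring R by (rule R_cring)

text \<open>
  Division by \<open>x\<close> identifies the colon ideal \<open>(x : \<mm>)\<close> with \<open>(R : \<mm>)\<close>, and \<open>(R : \<mm>)\<close> is the set of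
  series with exponents in \<open>S \<union> PF(S)\<close>, whatever \<open>x\<close> is. In terms of \<open>y = x/t\<close> this becomes
  \<open>(x : \<mm>) = y \<cdot> t (R : \<mm>)\<close>. That \<open>y\<close> divides an element \<open>a\<close> of the colon ideal is a matter of
  orders: the difference of the orders of \<open>a\<close> and \<open>x\<close> translates the positive elements of \<open>S\<close>
  into \<open>S\<close>, so it is at least \<open>-1\<close>.
\<close>

lemma socle_representatives_principal:
  assumes x: "x \<in> local_max_ideal R" "x \<noteq> 0"
  shows "a \<in> socle_representatives R (Idl\<^bsub>R\<^esub> {x}) \<longleftrightarrow>
    (\<exists>g. a = fps_shift 1 x * g \<and> (\<forall>n. g $ n \<noteq> 0 \<longrightarrow> n \<in> shifted_dual_exponents))"
proof -
  define y where "y = fps_shift 1 x"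
  have x0: "x $ 0 = 0" and xR: "x \<in> carrier R" using x by (auto simp: maximal_ideal_R)
  have xy: "x = y * fps_X"
    unfolding y_def using x x0 by (intro fps_ext) (simp add: fps_X_mult_right_nth)
  have pos: "x $ i \<noteq> 0 \<Longrightarrow> i \<in> S - {0}" for i using xR x0 by (cases "i = 0") (auto simp: mem_R)
  have ysupp: "Suc i \<in> S - {0}" if "y $ i \<noteq> 0" for i
    using pos[of "Suc i"] that by (simp add: y_def)
  have "a \<in> socle_representatives R (Idl\<^bsub>R\<^esub> {x})"
    if a: "a = y * g" and g: "\<And>n. g $ n \<noteq> 0 \<Longrightarrow> n \<in> shifted_dual_exponents" for g
  proof -
    have "n \<in> S" if "a $ n \<noteq> 0" for n
    proof (rule mult_supported[of y g])
      fix i j assume "y $ i \<noteq> 0" "g $ j \<noteq> 0"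
      then have "Suc i \<in> S - {0}" "j \<in> shifted_dual_exponents" using ysupp g by auto
      then have "j + Suc i - 1 \<in> S" unfolding shifted_dual_exponents_def by blast
      then show "i + j \<in> S" by (simp add: add.commute)
    qed (use that a in simp)
    then have aR: "a \<in> carrier R" by (simp add: mem_R)
    have "r * a \<in> Idl\<^bsub>R\<^esub> {x}" if r: "r \<in> local_max_ideal R" for r
    proof -
      have r0: "r $ 0 = 0" and rR: "r \<in> carrier R" using r by (auto simp: maximal_ideal_R)
      define q where "q = fps_shift 1 (r * g)"
      have "n \<in> {n. n - 1 \<in> S}" if "(r * g) $ n \<noteq> 0" for n
        using _ that
      proof (rule mult_supported)
        fix i j assume "r $ i \<noteq> 0" "g $ j \<noteq> 0"
        then have "i \<in> S - {0}" "j \<in> shifted_dual_exponents" using rR r0 g by (auto simp: mem_R intro: gr0I)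
        then have "j + i - 1 \<in> S" unfolding shifted_dual_exponents_def by blast
        then show "i + j \<in> {n. n - 1 \<in> S}" by (simp add: add.commute)
      qed
      from this[of "Suc n" for n] have "q \<in> carrier R" by (simp add: mem_R q_def)
      moreover have "r * g = q * fps_X"
        unfolding q_def using r0 by (intro fps_ext) (simp add: fps_X_mult_right_nth)
      then have "r * a = q * x" unfolding a xy by (simp add: mult.assoc mult.left_commute)
      ultimately show ?thesis unfolding Idl_singleton[OF xR] by blast
    qed
    then show ?thesis using aR by (simp add: socle_representatives_def)
  qed
  moreover have "\<exists>g. a = y * g \<and> (\<forall>n. g $ n \<noteq> 0 \<longrightarrow> n \<in> shifted_dual_exponents)"
    if soc: "a \<in> socle_representatives R (Idl\<^bsub>R\<^esub> {x})"
  proof (cases "a = 0")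
    case False
    have "\<exists>r\<in>carrier R. fps_X ^ s * a = r * x" if s: "s \<in> S - {0}" for s
    proof -
      have "fps_X ^ s \<in> local_max_ideal R" using s by (simp add: maximal_ideal_R X_power_in_R)
      then have "fps_X ^ s * a \<in> Idl\<^bsub>R\<^esub> {x}" using soc by (simp add: socle_representatives_def)
      then show ?thesis unfolding Idl_singleton[OF xR] by blast
    qed
    then obtain r where rR: "\<And>s. s \<in> S - {0} \<Longrightarrow> r s \<in> carrier R"
      and r: "\<And>s. s \<in> S - {0} \<Longrightarrow> fps_X ^ s * a = r s * x" by metis
    have "int (subdegree a) - int (subdegree x) + int s \<in> int ` S" if s: "s \<in> S - {0}" for s
    proof -
      have nz: "fps_X ^ s * a \<noteq> 0" using False by simp
      then have r0: "r s \<noteq> 0" using r[OF s] by auto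
      have "s + subdegree a = subdegree (fps_X ^ s * a)" using False by simp
      also have "\<dots> = subdegree (r s) + subdegree x" using r[OF s] r0 x(2) by simp
      finally have "int (subdegree a) - int (subdegree x) + int s = int (subdegree (r s))" by simp
      moreover have "subdegree (r s) \<in> S" using rR[OF s] r0 by (simp add: mem_R)
      ultimately show ?thesis by (metis imageI)
    qed
    then have "int (subdegree a) - int (subdegree x) \<ge> -1" by (rule translate_into_ge_minus_one)
    moreover have y0: "y \<noteq> 0" using xy x(2) by auto
    then have "subdegree x = subdegree y + 1" unfolding xy by simp
    ultimately have "subdegree y \<le> subdegree a" by simp
    then have "y dvd a" using False y0 by (simp add: fps_dvd_iff)
    then obtain g where g: "a = y * g" by blast
    have "n \<in> shifted_dual_exponents" if n: "g $ n \<noteq> 0" for n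
      unfolding shifted_dual_exponents_def
    proof (intro CollectI ballI)
      fix s assume s: "s \<in> S - {0}"
      have "y * (fps_X ^ s * g) = y * (r s * fps_X)"
        using r[OF s] unfolding g xy by (simp add: mult_ac)
      then have "fps_X ^ s * g = r s * fps_X" using y0 by simp
      then have "(r s * fps_X) $ (n + s) \<noteq> 0" using n by (metis add_diff_cancel_right' fps_X_power_mult_nth not_add_less2)
      then have "r s $ (n + s - 1) \<noteq> 0" using s by (simp add: fps_X_mult_right_nth split: if_splits)
      then show "n + s - 1 \<in> S" using rR[OF s] by (simp add: mem_R)
    qed
    then show ?thesis using g by blast
  qed (auto intro: exI[of _ 0])
  ultimately show ?thesis unfolding y_def by blast
qed

lemma socle_of_quotient_principal:
  "x \<in> carrier R \<Longrightarrow> socle_of_quotient R (Idl\<^bsub>R\<^esub> {x})"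
  by (intro socle_of_quotient.intro R_cring maximalideal_R R.genideal_ideal) simp

text \<open>
  By the preceding description, \<open>(x : \<mm>)/(x)\<close> is isomorphic to \<open>(R : \<mm>)/R\<close>, in which the powers
  \<open>t\<^sup>f\<close> with \<open>f \<in> PF(S)\<close> form a basis. The corresponding elements of \<open>(x : \<mm>)\<close> are
  \<open>x t\<^sup>f = y t\<^bsup>f+1\<^esup>\<close>.
\<close>

lemma socle_dim_eq_card_PF:
  assumes x: "x \<in> local_max_ideal R" "x \<noteq> 0"
  shows "vectorspace.dim (R Quot local_max_ideal R) (socle_module R (Idl\<^bsub>R\<^esub> {x})) = card (PF S)"
proof -
  let ?I = "Idl\<^bsub>R\<^esub> {x}" and ?Soc = "socle_representatives R (Idl\<^bsub>R\<^esub> {x})"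
  define y where "y = fps_shift 1 x"
  have x0: "x $ 0 = 0" and xR: "x \<in> carrier R" using x by (auto simp: maximal_ideal_R)
  have xy: "x = y * fps_X"
    unfolding y_def using x x0 by (intro fps_ext) (simp add: fps_X_mult_right_nth)
  then have y0: "y \<noteq> 0" using x by auto
  note Soc = socle_representatives_principal[OF x, folded y_def]
  define e where "e f = nat (f + 1)" for f
  have e: "int (e f) - 1 = f" if "f \<in> PF S" for f using PF_ge_minus_one[OF that] by (simp add: e_def)
  define b :: "int \<Rightarrow> 'k fps" where "b f = y * fps_X ^ e f" for f
  have bSoc: "b f \<in> ?Soc" if "f \<in> PF S" for f
    unfolding Soc b_def using e[OF that] that
    by (intro exI[of _ "fps_X ^ e f"]) (auto simp: fps_X_power_nth shifted_dual_exponents_iff)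
  have bR: "b f \<in> carrier R" if "f \<in> PF S" for f
    using bSoc[OF that] by (simp add: socle_representatives_def)
  have sum_eq: "(\<Oplus>\<^bsub>R\<^esub>f\<in>PF S. c f \<otimes>\<^bsub>R\<^esub> b f) = y * (\<Sum>f\<in>PF S. c f * fps_X ^ e f)"
    if c: "c \<in> PF S \<rightarrow> carrier R" for c
  proof -
    have "(\<Oplus>\<^bsub>R\<^esub>f\<in>PF S. c f \<otimes>\<^bsub>R\<^esub> b f) = (\<Sum>f\<in>PF S. c f * b f)"
      using c bR by (subst R_finsum) (auto simp: R_mult Pi_iff)
    then show ?thesis by (simp add: b_def sum_distrib_left mult.left_commute)
  qed
  show ?thesis
  proof (rule socle_of_quotient.socle_dim[OF socle_of_quotient_principal[OF xR]])
    show "finite (PF S)" by (rule finite_PF)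
    show "b \<in> PF S \<rightarrow> ?Soc" using bSoc by blast
  next
    fix c f0 assume c: "c \<in> PF S \<rightarrow> carrier R" and f0: "f0 \<in> PF S"
      and "(\<Oplus>\<^bsub>R\<^esub>f\<in>PF S. c f \<otimes>\<^bsub>R\<^esub> b f) \<in> ?I"
    then obtain r where r: "r \<in> carrier R" "y * (\<Sum>f\<in>PF S. c f * fps_X ^ e f) = r * x"
      unfolding sum_eq[OF c] Idl_singleton[OF xR] by blast
    have "y * (\<Sum>f\<in>PF S. c f * fps_X ^ e f) = y * (r * fps_X)"
      using r(2) unfolding xy by (simp add: mult_ac)
    then have sum: "(\<Sum>f\<in>PF S. c f * fps_X ^ e f) = r * fps_X" using y0 by simp
    \<comment> \<open>A term with \<open>f \<noteq> f0\<close> could contribute only if \<open>f0 - f\<close> were a positive element of \<open>S\<close>,\<close>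
    \<comment> \<open>but then \<open>f0\<close> would be in \<open>S\<close>, as \<open>f\<close> is pseudo-Frobenius.\<close>
    have "(\<Sum>f\<in>PF S. c f * fps_X ^ e f) $ e f0 = (\<Sum>f\<in>PF S. if f = f0 then c f0 $ 0 else 0)"
      unfolding fps_sum_nth
    proof (rule sum.cong[OF refl])
      fix f assume f: "f \<in> PF S"
      have "c f $ (e f0 - e f) = 0" if "f \<noteq> f0" "e f \<le> e f0"
      proof (rule ccontr)
        assume "c f $ (e f0 - e f) \<noteq> 0"
        moreover have "c f \<in> carrier R" using c f by (rule funcset_mem)
        ultimately have "e f0 - e f \<in> S" by (simp add: mem_R)
        moreover have diff: "int (e f0 - e f) = f0 - f" using e[OF f] e[OF f0] that by linarith
        ultimately have "e f0 - e f \<in> S - {0}" using that(1) by auto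
        then have "f + int (e f0 - e f) \<in> int ` S" using f unfolding PF_def by blast
        then have "f0 \<in> int ` S" unfolding diff by simp
        then show False using f0 unfolding PF_def by simp
      qed
      then show "(c f * fps_X ^ e f) $ e f0 = (if f = f0 then c f0 $ 0 else 0)"
        by (auto simp: fps_X_power_mult_right_nth)
    qed
    also have "\<dots> = c f0 $ 0" using f0 finite_PF by simp
    finally have "c f0 $ 0 = (r * fps_X) $ e f0" using sum by simp
    also have "\<dots> = 0"
    proof (rule ccontr)
      assume "(r * fps_X) $ e f0 \<noteq> 0"
      then have "e f0 \<noteq> 0" "e f0 - 1 \<in> S" using r(1) by (auto simp: fps_X_mult_right_nth mem_R split: if_splits)
      moreover have "int (e f0 - 1) = f0" using e[OF f0] \<open>e f0 \<noteq> 0\<close> by linarith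
      ultimately show False using f0 unfolding PF_def by (metis (lifting) imageI mem_Collect_eq)
    qed
    finally show "c f0 \<in> local_max_ideal R" using funcset_mem[OF c f0] by (simp add: maximal_ideal_R)
  next
    fix v assume v: "v \<in> ?Soc"
    then obtain g where g: "v = y * g" "\<And>n. g $ n \<noteq> 0 \<Longrightarrow> n \<in> shifted_dual_exponents"
      unfolding Soc by blast
    have vR: "v \<in> carrier R" using v by (simp add: socle_representatives_def)
    define c where "c f = fps_const (g $ e f)" for f
    have c: "c \<in> PF S \<rightarrow> carrier R" by (simp add: c_def const_in_R)
    \<comment> \<open>Removing the pseudo-Frobenius part of \<open>g\<close> leaves exponents in \<open>S + 1\<close>, hence a multiple\<close>
    \<comment> \<open>\<open>y h\<close> of \<open>x\<close>.\<close>
    define h where "h = g - (\<Sum>f\<in>PF S. c f * fps_X ^ e f)"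
    have e_inj: "f = f'" if "f \<in> PF S" "f' \<in> PF S" "e f = e f'" for f f'
      using e[OF that(1)] e[OF that(2)] that(3) by linarith
    have coeff: "(\<Sum>f\<in>PF S. c f * fps_X ^ e f) $ n = (\<Sum>f\<in>PF S. if e f = n then g $ n else 0)" for n
      by (auto simp: fps_sum_nth c_def fps_X_power_nth intro!: sum.cong)
    have h_PF: "h $ e f = 0" if f: "f \<in> PF S" for f
    proof -
      have "(\<Sum>f'\<in>PF S. if e f' = e f then g $ e f else 0) = (\<Sum>f'\<in>PF S. if f' = f then g $ e f else 0)"
        using e_inj f by (intro sum.cong) auto
      then show ?thesis using f finite_PF unfolding h_def by (simp add: coeff)
    qed
    have h_S: "n > 0 \<and> n - 1 \<in> S" if n: "h $ n \<noteq> 0" for n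
    proof -
      have ne: "e f \<noteq> n" if "f \<in> PF S" for f using h_PF[OF that] n by auto
      then have "(\<Sum>f\<in>PF S. if e f = n then g $ n else 0) = 0" by (intro sum.neutral) auto
      then have "g $ n \<noteq> 0" using n unfolding h_def by (simp add: coeff)
      then have "int n - 1 \<in> int ` S \<union> PF S" using g(2) shifted_dual_exponents_iff by blast
      moreover have "int n - 1 \<notin> PF S" using ne[of "int n - 1"] by (auto simp: e_def)
      ultimately obtain s where "s \<in> S" "int n - 1 = int s" by blast
      moreover from this have "n = Suc s" by linarith
      ultimately show ?thesis by simp
    qed
    define q where "q = fps_shift 1 h"
    have "h $ 0 = 0" using h_S by blast
    then have hq: "h = q * fps_X"
      unfolding q_def by (intro fps_ext) (simp add: fps_X_mult_right_nth)
    have "q \<in> carrier R" using h_S[of "Suc n" for n] by (simp add: mem_R q_def)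
    moreover have "v \<ominus>\<^bsub>R\<^esub> (\<Oplus>\<^bsub>R\<^esub>f\<in>PF S. c f \<otimes>\<^bsub>R\<^esub> b f) = q * x"
    proof -
      have "(\<Oplus>\<^bsub>R\<^esub>f\<in>PF S. c f \<otimes>\<^bsub>R\<^esub> b f) \<in> carrier R"
        using c bR by (intro R.finsum_closed) (auto simp: R_mult Pi_iff)
      then have "v \<ominus>\<^bsub>R\<^esub> (\<Oplus>\<^bsub>R\<^esub>f\<in>PF S. c f \<otimes>\<^bsub>R\<^esub> b f) = v - (\<Oplus>\<^bsub>R\<^esub>f\<in>PF S. c f \<otimes>\<^bsub>R\<^esub> b f)"
        by (rule R_minus[OF vR])
      also have "\<dots> = y * h" unfolding sum_eq[OF c] g(1) h_def by (simp add: right_diff_distrib)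
      finally show ?thesis unfolding hq xy by (simp add: mult_ac)
    qed
    ultimately have "v \<ominus>\<^bsub>R\<^esub> (\<Oplus>\<^bsub>R\<^esub>f\<in>PF S. c f \<otimes>\<^bsub>R\<^esub> b f) \<in> ?I"
      unfolding Idl_singleton[OF xR] by blast
    then show "\<exists>c\<in>PF S \<rightarrow> carrier R. v \<ominus>\<^bsub>R\<^esub> (\<Oplus>\<^bsub>R\<^esub>f\<in>PF S. c f \<otimes>\<^bsub>R\<^esub> b f) \<in> ?I"
      using c by blast
  qed
qed

lemma cm_type_eq: "cm_type R = card (PF S)"
proof -
  define xs where "xs = (SOME xs. maximal_regular_sequence R xs)"
  obtain c where c: "c > 0" "\<And>n. n \<ge> c \<Longrightarrow> n \<in> S" using conductor by blast
  then have "maximal_regular_sequence R [fps_X ^ c]"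
    by (simp add: maximal_regular_sequence_iff maximal_ideal_R X_power_in_R)
  then have "maximal_regular_sequence R xs" unfolding xs_def by (rule someI)
  then obtain x where "x \<in> local_max_ideal R" "x \<noteq> 0" "xs = [x]"
    by (auto simp: maximal_regular_sequence_iff)
  then show ?thesis using socle_dim_eq_card_PF unfolding cm_type_def xs_def[symmetric] by simp
qed

end

theorem cm_type_semigroup_ring:
  assumes "numerical_semigroup S"
  shows "cm_type (semigroup_ring TYPE('k::field) S) = card (PF S)"
proof -
  interpret semigroup_ring_over S "semigroup_ring TYPE('k) S"
    using assms by (unfold_locales)
  show ?thesis by (rule cm_type_eq)
qed

section \<open>Pseudo-Frobenius numbers of a duplication\<close>

locale duplication = nsemigroup S for S +
  fixes E :: "nat set" and d :: nat
  assumes E: "semigroup_ideal S E" "E \<noteq> {}" and d: "d \<in> S" "odd d"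
begin

abbreviation "T \<equiv> numerical_duplication S E d"

lemma E_sub: "e \<in> E \<Longrightarrow> e \<in> S" and E_add: "s \<in> S \<Longrightarrow> e \<in> E \<Longrightarrow> s + e \<in> E"
  using E unfolding semigroup_ideal_def by auto

lemma even_mem_T: "2 * m \<in> int ` T \<longleftrightarrow> m \<in> int ` S"
proof
  assume "2 * m \<in> int ` T"
  then obtain t where t: "t \<in> T" "2 * m = int t" by blast
  then have "even t" by presburger
  then obtain s where "s \<in> S" "t = 2 * s" using t(1) d(2) by (auto simp: numerical_duplication_def)
  then show "m \<in> int ` S" using t(2) by auto
next
  assume "m \<in> int ` S"
  then obtain s where "s \<in> S" "m = int s" by blast
  then have "2 * s \<in> T" "2 * m = int (2 * s)" by (auto simp: numerical_duplication_def)
  then show "2 * m \<in> int ` T" by (metis imageI)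
qed

lemma odd_mem_T: "2 * m + int d \<in> int ` T \<longleftrightarrow> m \<in> int ` E"
proof
  assume "2 * m + int d \<in> int ` T"
  then obtain t where t: "t \<in> T" "2 * m + int d = int t" by blast
  then have "odd t" using d(2) by presburger
  then obtain e where "e \<in> E" "t = 2 * e + d" using t(1) by (auto simp: numerical_duplication_def)
  then show "m \<in> int ` E" using t(2) by auto
next
  assume "m \<in> int ` E"
  then obtain e where "e \<in> E" "m = int e" by blast
  then have "2 * e + d \<in> T" "2 * m + int d = int (2 * e + d)" by (auto simp: numerical_duplication_def)
  then show "2 * m + int d \<in> int ` T" by (metis imageI)
qed

lemma T_nonzero: "(\<forall>t\<in>T - {0}. P t) \<longleftrightarrow> (\<forall>s\<in>S - {0}. P (2 * s)) \<and> (\<forall>e\<in>E. P (2 * e + d))"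
proof -
  have "d \<noteq> 0" using d(2) by (metis even_zero)
  then show ?thesis unfolding numerical_duplication_def by auto
qed

lemma even_mem_PF: "2 * f \<in> PF T \<longleftrightarrow> f \<in> PF S \<and> (\<forall>e\<in>E. f + int e \<in> int ` E)"
proof -
  have "2 * f + int (2 * s) = 2 * (f + int s)" "2 * f + int (2 * s + d) = 2 * (f + int s) + int d" for s
    by simp_all
  then show ?thesis
    unfolding PF_def mem_Collect_eq T_nonzero by (simp only: even_mem_T odd_mem_T) blast
qed

text \<open>
  Adding an odd element \<open>2 e + d\<close> imposes no condition of its own: \<open>e + d\<close> is a positive element of
  \<open>S\<close>, so the condition on \<open>S - {0}\<close> covers it.
\<close>

lemma odd_mem_PF: "2 * f + int d \<in> PF T \<longleftrightarrow> f \<notin> int ` E \<and> (\<forall>s\<in>S - {0}. f + int s \<in> int ` E)"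
proof -
  have eq: "2 * f + int d + int (2 * s) = 2 * (f + int s) + int d"
    "2 * f + int d + int (2 * s + d) = 2 * (f + int (s + d))" for s
    by simp_all
  have "f + int (e + d) \<in> int ` S" if "\<forall>s\<in>S - {0}. f + int s \<in> int ` E" "e \<in> E" for e
  proof -
    have "e + d \<in> S - {0}" using d add_mem[OF E_sub[OF that(2)] d(1)] by (auto elim: oddE)
    then have "f + int (e + d) \<in> int ` E" using that(1) by blast
    then show ?thesis using E_sub by blast
  qed
  then show ?thesis
    unfolding PF_def mem_Collect_eq T_nonzero by (simp only: eq even_mem_T odd_mem_T) blast
qed

lemma PF_duplication:
  "PF T = {2 * f | f. f \<in> PF S \<and> (\<forall>e\<in>E. f + int e \<in> int ` E)}
    \<union> {2 * f + int d | f. f \<notin> int ` E \<and> (\<forall>s\<in>S - {0}. f + int s \<in> int ` E)}"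
proof -
  have parity: "(\<exists>f. x = 2 * f) \<or> (\<exists>f. x = 2 * f + int d)" for x :: int
  proof (cases "even x")
    case False
    then have "even (x - int d)" using d(2) by simp
    then obtain f where "x - int d = 2 * f" by (rule evenE)
    then have "x = 2 * f + int d" by simp
    then show ?thesis by blast
  qed (auto elim: evenE)
  have "x \<in> PF T \<longleftrightarrow> x \<in> {2 * f | f. 2 * f \<in> PF T} \<union> {2 * f + int d | f. 2 * f + int d \<in> PF T}"
    for x using parity[of x] by blast
  then show ?thesis unfolding even_mem_PF odd_mem_PF by blast
qed

lemma zero_in_E_iff: "0 \<in> E \<longleftrightarrow> E = S"
  using E_sub E_add[of _ 0] zero_mem by auto

text \<open>
  It remains to rewrite the two conditions on \<open>f\<close> in terms of \<open>E \<union> {0}\<close>. Only \<open>0\<close> has to be watched: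
  \<open>f = 0\<close> would satisfy the condition for odd elements just when \<open>E = S - {0}\<close>, and a sum \<open>f + e\<close>
  is \<open>0\<close> only if \<open>E \<union> {0}\<close> consists of all natural numbers.
\<close>

lemma PF_duplication_proper:
  assumes "E \<noteq> S" "E \<noteq> S - {0}"
  shows "PF T = Delta1 S E \<union> Delta2 S E d"
proof -
  let ?E = "E \<union> {0}"
  have ns: "numerical_semigroup ?E" using numerical_semigroup_tilde[OF S E] .
  have E0: "0 \<notin> E" using assms zero_in_E_iff by blast
  then have nz: "?E - {0} = E" by blast
  have "?E \<noteq> UNIV"
  proof
    assume "?E = UNIV"
    then have "E = UNIV - {0}" "UNIV - {0} \<subseteq> S" using nz E_sub by auto
    then show False using assms zero_mem by auto
  qed
  note pf = PF_plus_mem_nonzero[OF ns this, unfolded nz]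
  have even: "f \<in> PF S \<and> (\<forall>e\<in>E. f + int e \<in> int ` E) \<longleftrightarrow> f \<in> PF S \<inter> PF ?E" for f
  proof -
    have "f \<in> PF ?E" if "f \<in> PF S" "\<forall>e\<in>E. f + int e \<in> int ` E"
    proof -
      have "f \<notin> int ` ?E" using that(1) E_sub zero_mem by (auto simp: PF_def)
      then show ?thesis using that(2) unfolding PF_def nz by blast
    qed
    then show ?thesis using pf by blast
  qed
  have odd: "f \<notin> int ` E \<and> (\<forall>s\<in>S - {0}. f + int s \<in> int ` E) \<longleftrightarrow>
      f \<in> PF ?E \<and> (\<forall>s\<in>S - ?E. f + int s \<in> int ` E)" for f
  proof
    assume f: "f \<notin> int ` E \<and> (\<forall>s\<in>S - {0}. f + int s \<in> int ` E)"
    have "f \<noteq> 0"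
    proof
      assume "f = 0"
      then have "S - {0} \<subseteq> E" using f by auto
      then show False using assms(2) E0 E_sub by blast
    qed
    then have "f \<notin> int ` ?E" using f by auto
    moreover have "E \<subseteq> S - {0}" using E_sub E0 by blast
    ultimately show "f \<in> PF ?E \<and> (\<forall>s\<in>S - ?E. f + int s \<in> int ` E)"
      using f unfolding PF_def nz by blast
  next
    assume f: "f \<in> PF ?E \<and> (\<forall>s\<in>S - ?E. f + int s \<in> int ` E)"
    have "f + int s \<in> int ` E" if "s \<in> S - {0}" for s
      using f pf that by (cases "s \<in> E") auto
    then show "f \<notin> int ` E \<and> (\<forall>s\<in>S - {0}. f + int s \<in> int ` E)"
      using f unfolding PF_def by blast
  qed
  show ?thesis unfolding PF_duplication Delta1_def Delta2_def even odd ..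
qed

text \<open>
  Here \<open>f = 0\<close> does satisfy the condition for odd elements; it accounts for the element \<open>d\<close>. For
  the semigroup of all natural numbers the formula fails: \<open>-1\<close> is pseudo-Frobenius and
  \<open>-1 + 1 = 0\<close> is not in \<open>E\<close>.
\<close>

lemma PF_duplication_maximal:
  assumes ES: "E = S - {0}" and "S \<noteq> UNIV"
  shows "PF T = {int d} \<union> {2 * f | f. f \<in> PF S} \<union> {2 * f + int d | f. f \<in> PF S}"
proof -
  note pf = PF_plus_mem_nonzero[OF S \<open>S \<noteq> UNIV\<close>, folded ES]
  have even: "f \<in> PF S \<and> (\<forall>e\<in>E. f + int e \<in> int ` E) \<longleftrightarrow> f \<in> PF S" for f
    using pf by blast
  have odd: "f \<notin> int ` E \<and> (\<forall>s\<in>S - {0}. f + int s \<in> int ` E) \<longleftrightarrow> f = 0 \<or> f \<in> PF S" for f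
  proof
    assume f: "f \<notin> int ` E \<and> (\<forall>s\<in>S - {0}. f + int s \<in> int ` E)"
    have "f \<in> PF S" if "f \<noteq> 0"
    proof -
      have "f \<notin> int ` S" using f that ES by auto
      then show ?thesis using f E_sub unfolding PF_def by blast
    qed
    then show "f = 0 \<or> f \<in> PF S" by blast
  next
    assume "f = 0 \<or> f \<in> PF S"
    then show "f \<notin> int ` E \<and> (\<forall>s\<in>S - {0}. f + int s \<in> int ` E)"
    proof
      assume "f = 0"
      then show ?thesis by (auto simp: ES)
    next
      assume f: "f \<in> PF S"
      then have "f \<notin> int ` E" using E_sub unfolding PF_def by blast
      then show ?thesis using pf[OF f] by (simp add: ES)
    qed
  qed
  show ?thesis unfolding PF_duplication even odd by auto
qed

lemma PF_duplication_whole: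
  assumes "E = S"
  shows "PF T = {2 * f + int d | f. f \<in> PF S}"
proof -
  have "\<not> (f \<in> PF S \<and> (\<forall>e\<in>E. f + int e \<in> int ` E))" for f
    using zero_mem unfolding PF_def assms by force
  then have "PF T = {2 * f + int d | f. f \<notin> int ` E \<and> (\<forall>s\<in>S - {0}. f + int s \<in> int ` E)}"
    unfolding PF_duplication by blast
  then show ?thesis unfolding assms by (simp add: PF_def)
qed

lemma card_PF_duplication_maximal:
  assumes "E = S - {0}" and "S \<noteq> UNIV"
  shows "card (PF T) = 2 * card (PF S) + 1"
proof -
  let ?A = "(\<lambda>f. 2 * f) ` PF S" and ?B = "(\<lambda>f. 2 * f + int d) ` PF S"
  have "0 \<notin> PF S" using zero_mem by (auto simp: PF_def)
  then have "int d \<notin> ?A \<union> ?B" using d(2) by auto presburger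
  moreover have "?A \<inter> ?B = {}" using d(2) by auto presburger
  moreover have "card ?A = card (PF S)" "card ?B = card (PF S)"
    by (auto intro!: card_image inj_onI)
  moreover have "PF T = insert (int d) (?A \<union> ?B)"
    unfolding PF_duplication_maximal[OF assms] by blast
  ultimately show ?thesis using finite_PF by (simp add: card_Un_disjoint)
qed

lemma card_PF_duplication_whole: "E = S \<Longrightarrow> card (PF T) = card (PF S)"
proof -
  assume "E = S"
  then have "PF T = (\<lambda>f. 2 * f + int d) ` PF S" using PF_duplication_whole by blast
  then show ?thesis by (simp add: card_image inj_on_def)
qed

end

section \<open>Pseudo-Frobenius numbers and type of a duplication\<close>

theorem theorem5p2:
  fixes S E :: "nat set" and d :: nat
  assumes "numerical_semigroup S"
    and "semigroup_ideal S E" and "E \<noteq> {}"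
    and "d \<in> S" and "odd d"
  shows
    "(E \<noteq> S \<and> E \<noteq> S - {0} \<longrightarrow>
        PF (numerical_duplication S E d) = Delta1 S E \<union> Delta2 S E d) \<and>
     (E = S - {0} \<and> S \<noteq> UNIV \<longrightarrow>
        PF (numerical_duplication S E d) =
          {int d} \<union> {2 * f | f. f \<in> PF S} \<union> {2 * f + int d | f. f \<in> PF S}) \<and>
     (E = S \<longrightarrow>
        PF (numerical_duplication S E d) = {2 * f + int d | f. f \<in> PF S}) \<and>
     (E \<noteq> S \<and> E \<noteq> S - {0} \<longrightarrow>
        cm_type (semigroup_ring TYPE('k::{alg_closed_field,field_char_0})
          (numerical_duplication S E d)) = card (Delta1 S E \<union> Delta2 S E d)) \<and>
     (E = S - {0} \<and> S \<noteq> UNIV \<longrightarrow>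
        cm_type (semigroup_ring TYPE('k) (numerical_duplication S E d)) =
          2 * cm_type (semigroup_ring TYPE('k) S) + 1) \<and>
     (E = S \<longrightarrow>
        cm_type (semigroup_ring TYPE('k) (numerical_duplication S E d)) =
          cm_type (semigroup_ring TYPE('k) S))"
proof -
  interpret duplication S E d by unfold_locales (use assms in auto)
  have types: "cm_type (semigroup_ring TYPE('k) T) = card (PF T)"
    "cm_type (semigroup_ring TYPE('k) S) = card (PF S)"
    using cm_type_semigroup_ring numerical_semigroup_duplication[OF assms] assms(1) by blast+
  show ?thesis
    unfolding types
  proof (intro conjI impI; (elim conjE)?)
    assume "E \<noteq> S" "E \<noteq> S - {0}"
    then show "PF T = Delta1 S E \<union> Delta2 S E d" by (rule PF_duplication_proper)
    then show "card (PF T) = card (Delta1 S E \<union> Delta2 S E d)" by (rule arg_cong)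
  qed (fact PF_duplication_maximal PF_duplication_whole
      card_PF_duplication_maximal card_PF_duplication_whole)+
qed

end
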